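(* Let $\kappa$ be a cardinal number with uncountable cofinality. Then every $\kappa$-injective Banach space $X$ has the $\kappa$-$\mathsf{SVM}$ property, in other words, $\tau(X)>\kappa$. Moreover, if $X$ is $(\lambda,\kappa)$-injective (and then the cofinality of $\kappa$ may be arbitrary), then $$v(\kappa,X)\leq 24\lambda K.$$
   Context: All Banach spaces are real. A set algebra is a family $\mathscr{F}$ of subsets of some set that contains $\varnothing$ and is closed under complementation and finite unions. A vector measure is a finitely additive map $\mu\colon\mathscr{F}\to X$. A map $\nu\colon\mathscr{F}\to X$ is $1$-additive if $\|\nu(A\cup B)-\nu(A)-\nu(B)\|\leq 1$ for all disjoint $A,B\in\mathscr{F}$. A Banach space $X$ has the $\mathsf{SVM}$ property if there is $v<\infty$, depending only on $X$, such that for every set algebra $\mathscr{F}$ and every $1$-additive $\nu\colon\mathscr{F}\to X$ there is a vector measure $\mu\colon\mathscr{F}\to X$ with $\|\nu(A)-\mu(A)\|\leq v$ for all $A\in\mathscr{F}$. For a cardinal $\kappa$, $X$ has the $\kappa$-$\mathsf{SVM}$ property if there is such a constant, depending only on $\kappa$ and $X$, that works for all set algebras with $|\mathscr{F}|<\kappa$; then $v(\kappa,X)$ denotes the infimum of all such constants. If $X$ does not have the $\mathsf{SVM}$ property, $\tau(X)$ is the least cardinal $\kappa$ such that $X$ does not have the $\kappa$-$\mathsf{SVM}$ property; by convention $\tau(X)>\kappa$ means that either $X$ has the $\mathsf{SVM}$ property, or it does not and the inequality holds. $X$ is $\kappa$-injective if for every Banach space $E$ with density character less than $\kappa$ and every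 (closed) subspace $F\subset E$, every bounded operator $t\colon F\to X$ extends to a bounded operator $T\colon E\to X$. If, for some $\lambda\geq 1$, there is always such an extension with $\|T\|\leq\lambda\|t\|$, then $X$ is $(\lambda,\kappa)$-injective. $K$ is the Kalton--Roberts constant: the best (least) constant such that for every set algebra $\mathscr{F}$ and every $1$-additive $\nu\colon\mathscr{F}\to\mathbb{R}$ there is a finitely additive $\mu\colon\mathscr{F}\to\mathbb{R}$ with $|\nu(A)-\mu(A)|\leq K$ for all $A\in\mathscr{F}$ (Kalton and Roberts proved such a constant exists and $K<45$).
   Formalization: In the "Moreover" part κ is assumed uncountable (of arbitrary cofinality): for κ = ℵ₀ every Banach space is vacuously (1,κ)-injective, and the bound fails, e.g. for the kernel of a quotient map from ℓ₁ onto c₀. *)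

theory Defs
  imports "HOL-Analysis.Analysis"
begin

unbundle cardinal_syntax

section \<open>Nearly additive maps and the SVM property\<close>

text \<open>
  Set algebras are the library's \<^locale>\<open>algebra\<close>, and vector measures are maps that are
  additive on disjoint pairs (the library's \<^const>\<open>Measure_Space.additive\<close>).
  Only the values on the algebra matter.
\<close>

definition one_additive :: "'p set set \<Rightarrow> ('p set \<Rightarrow> 'x::real_normed_vector) \<Rightarrow> bool" where
  "one_additive \<F> \<nu> \<longleftrightarrow>
     (\<forall>A\<in>\<F>. \<forall>B\<in>\<F>. A \<inter> B = {} \<longrightarrow> norm (\<nu> (A \<union> B) - \<nu> A - \<nu> B) \<le> 1)"

definition SVM_on :: "'p set set \<Rightarrow> 'x::real_normed_vector itself \<Rightarrow> real \<Rightarrow> bool" where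
  "SVM_on \<F> X v \<longleftrightarrow>
     (\<forall>\<nu> :: 'p set \<Rightarrow> 'x. one_additive \<F> \<nu> \<longrightarrow>
        (\<exists>\<mu> :: 'p set \<Rightarrow> 'x. Measure_Space.additive \<F> \<mu> \<and> (\<forall>A\<in>\<F>. norm (\<nu> A - \<mu> A) \<le> v)))"

text \<open>
  A cardinal is a cardinal order \<open>\<kappa> :: 'k rel\<close>.  The definition ranges over all set algebras
  of cardinality less than \<open>\<kappa>\<close> whose points are taken from the type \<open>'k\<close>.  This is no
  restriction: \<open>SVM_constants_any_algebra\<close> below shows that the same constants then work for
  all such algebras over any type of points.
\<close>

definition SVM_constants :: "'k rel \<Rightarrow> 'x::real_normed_vector itself \<Rightarrow> real set" where
  "SVM_constants \<kappa> X =
     {v. 0 \<le> v \<and> (\<forall>\<Omega> (\<F> :: 'k set set). algebra \<Omega> \<F> \<and> |\<F>| <o \<kappa> \<longrightarrow> SVM_on \<F> X v)}"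

definition SVM_property :: "'k rel \<Rightarrow> 'x::real_normed_vector itself \<Rightarrow> bool" where
  "SVM_property \<kappa> X \<longleftrightarrow> SVM_constants \<kappa> X \<noteq> {}"

text \<open>Meaningful only if the set of constants is nonempty, that is, under \<^const>\<open>SVM_property\<close>.\<close>

definition SVM_constant :: "'k rel \<Rightarrow> 'x::real_normed_vector itself \<Rightarrow> real" where
  "SVM_constant \<kappa> X = Inf (SVM_constants \<kappa> X)"

text \<open>
  \<open>\<tau>(X) > \<kappa>\<close>: the least cardinal \<open>\<kappa>'\<close> for which the \<open>\<kappa>'\<close>-SVM property fails, if there
  is one at all, exceeds \<open>\<kappa>\<close>; that is, no cardinal \<open>\<kappa>' \<le> \<kappa>\<close> is a failure.  Every cardinal
  \<open>\<kappa>' \<le> \<kappa>\<close> is represented by a cardinal order on the type of \<open>\<kappa>\<close>.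
\<close>

definition SVM_character_greater :: "'x::real_normed_vector itself \<Rightarrow> 'k rel \<Rightarrow> bool" where
  "SVM_character_greater X \<kappa> \<longleftrightarrow>
     \<not> (\<exists>\<kappa>' :: 'k rel. Card_order \<kappa>' \<and> \<kappa>' \<le>o \<kappa> \<and> \<not> SVM_property \<kappa>' X)"

text \<open>
  The Kalton--Roberts constant.  Set algebras over the natural numbers suffice, by
  \<open>Kalton_Roberts_any_algebra\<close> below.
\<close>

definition Kalton_Roberts_constants :: "real set" where
  "Kalton_Roberts_constants =
     {c. 0 \<le> c \<and> (\<forall>\<Omega> (\<F> :: nat set set). algebra \<Omega> \<F> \<longrightarrow> SVM_on \<F> TYPE(real) c)}"

definition Kalton_Roberts_constant :: real where
  "Kalton_Roberts_constant = Inf Kalton_Roberts_constants"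


section \<open>Uncountable cofinality\<close>

text \<open>
  \<^const>\<open>cofinal\<close> requires strict upper bounds, so it has the usual meaning for limit ordinals
  only; hence the first conjunct.
\<close>

definition uncountable_cofinality :: "'k rel \<Rightarrow> bool" where
  "uncountable_cofinality \<kappa> \<longleftrightarrow>
     infinite (Field \<kappa>) \<and> (\<forall>A. A \<subseteq> Field \<kappa> \<and> cofinal A \<kappa> \<longrightarrow> \<not> countable A)"


section \<open>Banach spaces on a carrier set\<close>

text \<open>
  The definition of injectivity quantifies over Banach spaces inside a formula, so these
  are given by a carrier set and explicit operations.
\<close>

record 'e nspace =
  carr :: "'e set"
  vadd :: "'e \<Rightarrow> 'e \<Rightarrow> 'e"
  vzero :: 'e
  vscale :: "real \<Rightarrow> 'e \<Rightarrow> 'e"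
  vnorm :: "'e \<Rightarrow> real"

locale normed_space_on =
  fixes E :: "'e nspace" (structure)
  assumes zero_closed: "vzero E \<in> carr E"
    and add_closed: "\<lbrakk>x \<in> carr E; y \<in> carr E\<rbrakk> \<Longrightarrow> vadd E x y \<in> carr E"
    and scale_closed: "x \<in> carr E \<Longrightarrow> vscale E a x \<in> carr E"
    and add_assoc: "\<lbrakk>x \<in> carr E; y \<in> carr E; z \<in> carr E\<rbrakk>
          \<Longrightarrow> vadd E (vadd E x y) z = vadd E x (vadd E y z)"
    and add_commute: "\<lbrakk>x \<in> carr E; y \<in> carr E\<rbrakk> \<Longrightarrow> vadd E x y = vadd E y x"
    and add_zero: "x \<in> carr E \<Longrightarrow> vadd E x (vzero E) = x"
    and add_inverse: "x \<in> carr E \<Longrightarrow> vadd E x (vscale E (-1) x) = vzero E"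
    and scale_add: "\<lbrakk>x \<in> carr E; y \<in> carr E\<rbrakk>
          \<Longrightarrow> vscale E a (vadd E x y) = vadd E (vscale E a x) (vscale E a y)"
    and add_scale: "x \<in> carr E \<Longrightarrow> vscale E (a + b) x = vadd E (vscale E a x) (vscale E b x)"
    and scale_scale: "x \<in> carr E \<Longrightarrow> vscale E a (vscale E b x) = vscale E (a * b) x"
    and scale_one: "x \<in> carr E \<Longrightarrow> vscale E 1 x = x"
    and norm_eq_zero: "x \<in> carr E \<Longrightarrow> vnorm E x = 0 \<longleftrightarrow> x = vzero E"
    and norm_triangle: "\<lbrakk>x \<in> carr E; y \<in> carr E\<rbrakk>
          \<Longrightarrow> vnorm E (vadd E x y) \<le> vnorm E x + vnorm E y"
    and norm_scale: "x \<in> carr E \<Longrightarrow> vnorm E (vscale E a x) = \<bar>a\<bar> * vnorm E x"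

text \<open>
  The value outside the carrier is set to \<open>0\<close> because \<^locale>\<open>Metric_space\<close> demands
  a symmetric and nonnegative distance on the whole type.
\<close>

definition vdist :: "'e nspace \<Rightarrow> 'e \<Rightarrow> 'e \<Rightarrow> real" where
  "vdist E x y =
     (if x \<in> carr E \<and> y \<in> carr E then vnorm E (vadd E x (vscale E (-1) y)) else 0)"

abbreviation norm_topology :: "'e nspace \<Rightarrow> 'e topology" where
  "norm_topology E \<equiv> Metric_space.mtopology (carr E) (vdist E)"

definition Banach_space_on :: "'e nspace \<Rightarrow> bool" where
  "Banach_space_on E \<longleftrightarrow> normed_space_on E \<and> Metric_space.mcomplete (carr E) (vdist E)"

definition density_character_less :: "'e nspace \<Rightarrow> 'k rel \<Rightarrow> bool" where
  "density_character_less E \<kappa> \<longleftrightarrow>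
     (\<exists>D \<subseteq> carr E. norm_topology E closure_of D = carr E \<and> |D| <o \<kappa>)"

definition closed_subspace :: "'e nspace \<Rightarrow> 'e set \<Rightarrow> bool" where
  "closed_subspace E F \<longleftrightarrow>
     F \<subseteq> carr E \<and> vzero E \<in> F \<and> (\<forall>x\<in>F. \<forall>y\<in>F. vadd E x y \<in> F) \<and>
     (\<forall>a. \<forall>x\<in>F. vscale E a x \<in> F) \<and> closedin (norm_topology E) F"

definition bounded_operator ::
    "'e nspace \<Rightarrow> 'e set \<Rightarrow> ('e \<Rightarrow> 'x::real_normed_vector) \<Rightarrow> bool" where
  "bounded_operator E F t \<longleftrightarrow>
     (\<forall>x\<in>F. \<forall>y\<in>F. t (vadd E x y) = t x + t y) \<and>
     (\<forall>a. \<forall>x\<in>F. t (vscale E a x) = a *\<^sub>R t x) \<and>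
     (\<exists>b. \<forall>x\<in>F. norm (t x) \<le> b * vnorm E x)"

text \<open>As in \<^const>\<open>onorm\<close>, the quotient at the zero vector is \<open>0\<close>.\<close>

definition operator_norm ::
    "'e nspace \<Rightarrow> 'e set \<Rightarrow> ('e \<Rightarrow> 'x::real_normed_vector) \<Rightarrow> real" where
  "operator_norm E F t = (SUP x\<in>F. norm (t x) / vnorm E x)"


section \<open>Injectivity\<close>

text \<open>
  A Banach space of density character less than \<open>\<kappa>\<close> has at most as many elements as there are
  sequences in \<open>\<kappa>\<close>, so up to an isometric isomorphism its carrier lies in the type
  \<open>nat \<Rightarrow> 'k\<close>.  By \<open>cardinal_injective_any_space\<close> and \<open>lambda_injective_any_space\<close> below
  the definitions therefore cover the Banach spaces over every type.

  For \<open>\<kappa> \<le> \<aleph>\<^sub>0\<close> the only space of density character less than \<open>\<kappa>\<close> is the zero space, so that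
  every Banach space is \<open>\<kappa>\<close>-injective; statements about injectivity are meant for uncountable \<open>\<kappa>\<close>.
\<close>

definition cardinal_injective :: "'k rel \<Rightarrow> 'x::banach itself \<Rightarrow> bool" where
  "cardinal_injective \<kappa> X \<longleftrightarrow>
     (\<forall>(E :: (nat \<Rightarrow> 'k) nspace) F (t :: (nat \<Rightarrow> 'k) \<Rightarrow> 'x).
        Banach_space_on E \<and> density_character_less E \<kappa> \<and> closed_subspace E F \<and>
        bounded_operator E F t \<longrightarrow>
        (\<exists>T. bounded_operator E (carr E) T \<and> (\<forall>x\<in>F. T x = t x)))"

definition lambda_injective :: "real \<Rightarrow> 'k rel \<Rightarrow> 'x::banach itself \<Rightarrow> bool" where
  "lambda_injective l \<kappa> X \<longleftrightarrow>
     (\<forall>(E :: (nat \<Rightarrow> 'k) nspace) F (t :: (nat \<Rightarrow> 'k) \<Rightarrow> 'x).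
        Banach_space_on E \<and> density_character_less E \<kappa> \<and> closed_subspace E F \<and>
        bounded_operator E F t \<longrightarrow>
        (\<exists>T. bounded_operator E (carr E) T \<and> (\<forall>x\<in>F. T x = t x) \<and>
             operator_norm E (carr E) T \<le> l * operator_norm E F t))"


section \<open>The choice of the carrier types is no restriction\<close>

subsection \<open>Set algebras\<close>

lemma one_additiveD:
  "\<lbrakk>one_additive F n; A \<in> F; B \<in> F; A \<inter> B = {}\<rbrakk> \<Longrightarrow> norm (n (A \<union> B) - n A - n B) \<le> 1"
  by (simp add: one_additive_def)

lemma SVM_on_transfer:
  fixes \<F> :: "'p set set" and \<G> :: "'q set set" and X :: "'x::real_normed_vector itself"
  assumes "SVM_on \<G> X v" and bij: "bij_betw \<phi> \<F> \<G>"
    and alg: "algebra \<Omega> \<F>"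
    and un: "\<And>A B. \<lbrakk>A \<in> \<F>; B \<in> \<F>\<rbrakk> \<Longrightarrow> \<phi> (A \<union> B) = \<phi> A \<union> \<phi> B"
    and dis: "\<And>A B. \<lbrakk>A \<in> \<F>; B \<in> \<F>\<rbrakk> \<Longrightarrow> A \<inter> B = {} \<longleftrightarrow> \<phi> A \<inter> \<phi> B = {}"
  shows "SVM_on \<F> X v"
  unfolding SVM_on_def
proof (intro allI impI)
  fix \<nu> :: "'p set \<Rightarrow> 'x" assume \<nu>: "one_additive \<F> \<nu>"
  interpret algebra \<Omega> \<F> by (rule alg)
  define \<psi> where "\<psi> = the_inv_into \<F> \<phi>"
  have inj: "inj_on \<phi> \<F>" and im: "\<phi> ` \<F> = \<G>" using bij by (auto simp: bij_betw_def)
  have \<psi>\<phi>: "\<psi> (\<phi> A) = A" if "A \<in> \<F>" for A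
    using that inj by (simp add: \<psi>_def the_inv_into_f_f)
  have "one_additive \<G> (\<nu> \<circ> \<psi>)"
    unfolding one_additive_def im[symmetric]
  proof (intro ballI impI; elim imageE; clarsimp)
    fix A B assume "A \<in> \<F>" "B \<in> \<F>" "\<phi> A \<inter> \<phi> B = {}"
    then show "norm (\<nu> (\<psi> (\<phi> A \<union> \<phi> B)) - \<nu> (\<psi> (\<phi> A)) - \<nu> (\<psi> (\<phi> B))) \<le> 1"
      using \<nu> dis[of A B] by (simp add: un[symmetric] \<psi>\<phi> Un one_additiveD)
  qed
  then obtain m where m: "Measure_Space.additive \<G> m" "\<And>A. A \<in> \<G> \<Longrightarrow> norm ((\<nu> \<circ> \<psi>) A - m A) \<le> v"
    using assms(1) unfolding SVM_on_def by blast
  have "Measure_Space.additive \<F> (m \<circ> \<phi>)"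
    unfolding Measure_Space.additive_def
  proof (intro ballI impI)
    fix A B assume AB: "A \<in> \<F>" "B \<in> \<F>" "A \<inter> B = {}"
    then have "\<phi> A \<in> \<G>" "\<phi> B \<in> \<G>" "\<phi> A \<inter> \<phi> B = {}" using im dis[of A B] by auto
    then show "(m \<circ> \<phi>) (A \<union> B) = (m \<circ> \<phi>) A + (m \<circ> \<phi>) B"
      using m(1) AB un unfolding Measure_Space.additive_def by simp
  qed
  moreover have "norm (\<nu> A - (m \<circ> \<phi>) A) \<le> v" if "A \<in> \<F>" for A
    using m(2)[of "\<phi> A"] that im \<psi>\<phi> by auto
  ultimately show "\<exists>\<mu>. Measure_Space.additive \<F> \<mu> \<and> (\<forall>A\<in>\<F>. norm (\<nu> A - \<mu> A) \<le> v)" by blast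
qed

lemma ordLess_imp_inj:
  fixes A :: "'a set" and \<kappa> :: "'k rel"
  assumes "Card_order \<kappa>" "|A| <o \<kappa>"
  obtains g :: "'a \<Rightarrow> 'k" where "inj_on g A"
proof -
  have "|A| \<le>o |Field \<kappa>|"
    using assms by (meson card_of_Field_ordIso ordIso_symmetric ordLeq_ordIso_trans ordLess_imp_ordLeq)
  then show thesis using that by (auto simp flip: card_of_ordLeq)
qed

theorem SVM_constants_any_algebra:
  fixes \<kappa> :: "'k rel" and \<F> :: "'p set set" and X :: "'x::real_normed_vector itself"
  assumes \<kappa>: "Card_order \<kappa>" and v: "v \<in> SVM_constants \<kappa> X"
    and alg: "algebra \<Omega> \<F>" and card: "|\<F>| <o \<kappa>"
  shows "SVM_on \<F> X v"
proof -
  interpret algebra \<Omega> \<F> by (rule alg)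
  define p where "p A = (SOME x. x \<in> A)" for A :: "'p set"
  have p: "p A \<in> A" if "A \<noteq> {}" for A unfolding p_def using that by (simp add: some_in_eq)
  define P where "P = p ` (\<F> - {{}})"
  have "|P| \<le>o |\<F> - {{}}|" unfolding P_def by (rule card_of_image)
  also have "|\<F> - {{}}| \<le>o |\<F>|" by (rule card_of_mono1) auto
  finally have "|P| <o \<kappa>" using card by (rule ordLeq_ordLess_trans)
  then obtain g :: "'p \<Rightarrow> 'k" where g: "inj_on g P" using ordLess_imp_inj \<kappa> by blast
  define \<phi> where "\<phi> A = g ` (A \<inter> P)" for A
  have un: "\<phi> (A \<union> B) = \<phi> A \<union> \<phi> B" for A B unfolding \<phi>_def by blast
  have diff: "\<phi> (A - B) = \<phi> A - \<phi> B" for A B unfolding \<phi>_def using g by (auto simp: inj_on_def)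
  have int: "\<phi> (A \<inter> B) = \<phi> A \<inter> \<phi> B" for A B unfolding \<phi>_def using g by (auto simp: inj_on_def)
  have ne: "\<phi> A = {} \<longleftrightarrow> A = {}" if "A \<in> \<F>" for A
    using that p[of A] unfolding \<phi>_def P_def by auto
  have dis: "A \<inter> B = {} \<longleftrightarrow> \<phi> A \<inter> \<phi> B = {}" if "A \<in> \<F>" "B \<in> \<F>" for A B
    using ne[OF Int[OF that]] by (auto simp: int)
  have inj: "inj_on \<phi> \<F>"
  proof (rule inj_onI)
    fix A B assume AB: "A \<in> \<F>" "B \<in> \<F>" "\<phi> A = \<phi> B"
    then have "\<phi> (A - B) = {}" "\<phi> (B - A) = {}" by (simp_all add: diff)
    then show "A = B" using ne[of "A - B"] ne[of "B - A"] AB by auto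
  qed
  have "algebra (\<phi> \<Omega>) (\<phi> ` \<F>)"
    unfolding algebra_iff_Un
  proof (intro conjI ballI)
    show "\<phi> ` \<F> \<subseteq> Pow (\<phi> \<Omega>)" using space_closed by (auto simp: \<phi>_def)
    show "{} \<in> \<phi> ` \<F>" using ne[of "{}"] by (metis empty_sets imageI)
    show "\<phi> \<Omega> - a \<in> \<phi> ` \<F>" if "a \<in> \<phi> ` \<F>" for a
      using that by (auto simp flip: diff intro!: imageI)
    show "a \<union> b \<in> \<phi> ` \<F>" if "a \<in> \<phi> ` \<F>" "b \<in> \<phi> ` \<F>" for a b
      using that by (auto simp flip: un intro!: imageI)
  qed
  moreover have "|\<phi> ` \<F>| <o \<kappa>" using card_of_image card by (rule ordLeq_ordLess_trans)
  ultimately have "SVM_on (\<phi> ` \<F>) X v" using v unfolding SVM_constants_def by blast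
  then show ?thesis
    by (rule SVM_on_transfer[where \<phi>=\<phi> and \<Omega>=\<Omega>])
       (use inj alg un dis in \<open>auto simp: bij_betw_def\<close>)
qed

theorem Kalton_Roberts_any_algebra:
  fixes \<F> :: "'p set set"
  assumes c: "c \<in> Kalton_Roberts_constants" and alg: "algebra \<Omega> \<F>"
  shows "SVM_on \<F> TYPE(real) c"
  unfolding SVM_on_def
proof (intro allI impI)
  fix \<nu> :: "'p set \<Rightarrow> real" assume \<nu>: "one_additive \<F> \<nu>"
  interpret algebra \<Omega> \<F> by (rule alg)
  define Q where "Q = {(A, B). A \<in> \<F> \<and> B \<in> \<F> \<and> A \<inter> B = {}}"
  define I where "I A = {\<nu> A - c..\<nu> A + c}" for A
  define S :: "('p set \<Rightarrow> real) set" where "S = (\<Pi>\<^sub>E A\<in>UNIV. I A)"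
  define T where "T q = {m :: 'p set \<Rightarrow> real. m (fst q \<union> snd q) = m (fst q) + m (snd q)}" for q
  have c0: "0 \<le> c" using c by (simp add: Kalton_Roberts_constants_def)
  have "compactin (product_topology (\<lambda>_. euclidean) UNIV) S"
    unfolding S_def compactin_PiE by (auto simp: I_def)
  then have "compact S" by (simp add: euclidean_product_topology)
  moreover have "closed (T q)" for q
    unfolding T_def by (intro closed_Collect_eq continuous_intros continuous_on_product_coordinates)
  moreover have "S \<inter> \<Inter> \<T> \<noteq> {}" if fin: "finite \<T>" and sub: "\<T> \<subseteq> T ` Q" for \<T>
  proof -
    obtain Q0 where Q0: "finite Q0" "Q0 \<subseteq> Q" "\<T> = T ` Q0"
      using finite_subset_image[OF fin sub] by blast
    define F0 where "F0 = fst ` Q0 \<union> snd ` Q0"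
    have F0: "finite F0" "F0 \<subseteq> \<F>" using Q0 by (auto simp: F0_def Q_def)
    define a where "a x = {A \<in> F0. x \<in> A}" for x
    have aF: "a x \<subseteq> F0" for x by (auto simp: a_def)
    have fa: "finite (a ` \<Omega>)"
      by (rule finite_subset[of _ "Pow F0"]) (use F0 in \<open>auto simp: a_def\<close>)
    then obtain e :: "'p set set \<Rightarrow> nat" where e: "inj_on e (a ` \<Omega>)"
      using finite_imp_inj_to_nat_seg by metis
    define h where "h x = e (a x)" for x
    have fh: "finite (h ` \<Omega>)" using finite_imageI[OF fa, of e] by (simp add: h_def image_image)
    have ha: "a x = a y" if "h x = h y" "x \<in> \<Omega>" "y \<in> \<Omega>" for x y
      using that e by (auto simp: h_def inj_on_def)
    have atom: "{y \<in> \<Omega>. a y = s} \<in> \<F>" if "s \<subseteq> F0" for s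
    proof -
      have "finite s" using that F0 finite_subset by auto
      have "{y \<in> \<Omega>. a y = s} = \<Omega> \<inter> (\<Inter>A\<in>F0. if A \<in> s then A else \<Omega> - A)"
      proof (rule set_eqI)
        fix y
        have "a y = s \<longleftrightarrow> (\<forall>A\<in>F0. A \<in> s \<longleftrightarrow> y \<in> A)" using that unfolding a_def by blast
        then show "y \<in> {y \<in> \<Omega>. a y = s} \<longleftrightarrow> y \<in> \<Omega> \<inter> (\<Inter>A\<in>F0. if A \<in> s then A else \<Omega> - A)"
          by (simp split: if_split) blast
      qed
      moreover have "\<Omega> \<inter> (\<Inter>A\<in>G. if A \<in> s then A else \<Omega> - A) \<in> \<F>" if "G \<subseteq> F0" for G
        using finite_subset[OF that F0(1)] that
      proof (induction G rule: finite_induct)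
        case empty then show ?case by simp
      next
        case (insert B G)
        let ?R = "\<Omega> \<inter> (\<Inter>A\<in>G. if A \<in> s then A else \<Omega> - A)"
        have "?R \<inter> (if B \<in> s then B else \<Omega> - B) \<in> \<F>" using insert F0 by auto
        moreover have "?R \<inter> (if B \<in> s then B else \<Omega> - B)
            = \<Omega> \<inter> (\<Inter>A\<in>insert B G. if A \<in> s then A else \<Omega> - A)"
          unfolding INT_insert by (simp only: Int_ac)
        ultimately show ?case by metis
      qed
      ultimately show ?thesis by auto
    qed
    have pre: "{y \<in> \<Omega>. h y \<in> N} \<in> \<F>" for N
    proof -
      have "{y \<in> \<Omega>. h y \<in> N} = (\<Union>s\<in>{s \<in> a ` \<Omega>. e s \<in> N}. {y \<in> \<Omega>. a y = s})"
        by (auto simp: h_def)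
      moreover have "\<dots> \<in> \<F>"
        by (rule finite_UN) (use fa atom[OF aF] in auto)
      ultimately show ?thesis by simp
    qed
    define \<nu>' where "\<nu>' N = \<nu> {y \<in> \<Omega>. h y \<in> N}" for N
    have "one_additive (Pow (h ` \<Omega>)) \<nu>'"
      unfolding one_additive_def
    proof (intro ballI impI)
      fix M N assume "M \<inter> N = ({}::nat set)"
      then show "norm (\<nu>' (M \<union> N) - \<nu>' M - \<nu>' N) \<le> 1"
        using one_additiveD[OF \<nu> pre[of M] pre[of N]]
        by (auto simp: \<nu>'_def Collect_disj_eq conj_disj_distribL disjoint_iff)
    qed
    moreover have "algebra (h ` \<Omega>) (Pow (h ` \<Omega>))" by (rule algebra_Pow)
    ultimately obtain m where m: "Measure_Space.additive (Pow (h ` \<Omega>)) m"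
      "\<And>N. N \<subseteq> h ` \<Omega> \<Longrightarrow> norm (\<nu>' N - m N) \<le> c"
      using c unfolding Kalton_Roberts_constants_def SVM_on_def by blast
    define m' where "m' A = (if \<exists>N. A = {y \<in> \<Omega>. h y \<in> N} then m (h ` A) else \<nu> A)" for A
    have sat: "{y \<in> \<Omega>. h y \<in> h ` A} = A" if "A \<in> F0" for A
      using that ha F0(2) sets_into_space by (fastforce simp: a_def)
    have satU: "{y \<in> \<Omega>. h y \<in> h ` (A \<union> B)} = A \<union> B" if "A \<in> F0" "B \<in> F0" for A B
      using sat[OF that(1)] sat[OF that(2)] by (auto simp: image_Un)
    have m'A: "m' A = m (h ` A)" if "{y \<in> \<Omega>. h y \<in> h ` A} = A" for A
      using that unfolding m'_def by metis
    have "m' A \<in> I A" for A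
    proof (cases "\<exists>N. A = {y \<in> \<Omega>. h y \<in> N}")
      case True
      then have "A = {y \<in> \<Omega>. h y \<in> h ` A}" "h ` A \<subseteq> h ` \<Omega>" by auto
      then have "\<bar>\<nu> A - m (h ` A)\<bar> \<le> c" using m(2)[of "h ` A"] by (simp add: \<nu>'_def)
      then show ?thesis using True by (simp add: m'_def I_def abs_le_iff)
    next
      case False then show ?thesis using c0 by (simp add: m'_def I_def)
    qed
    then have "m' \<in> S" by (simp add: S_def PiE_iff)
    moreover have "m' \<in> T q" if q: "q \<in> Q0" for q
    proof -
      obtain A B where AB: "q = (A, B)" by force
      then have F: "A \<in> F0" "B \<in> F0" "A \<inter> B = {}" using q Q0 by (auto simp: F0_def Q_def image_iff) force+
      have "h ` A \<inter> h ` B = {}"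
      proof (rule ccontr)
        assume "h ` A \<inter> h ` B \<noteq> {}"
        then obtain x y where "x \<in> A" "y \<in> B" "h x = h y" by auto
        then have "x \<in> {y \<in> \<Omega>. h y \<in> h ` B}" using F F0 sets_into_space by auto
        then show False using sat[OF F(2)] \<open>x \<in> A\<close> F(3) by auto
      qed
      moreover have "h ` A \<subseteq> h ` \<Omega>" "h ` B \<subseteq> h ` \<Omega>" using F F0 sets_into_space by blast+
      ultimately have "m (h ` A \<union> h ` B) = m (h ` A) + m (h ` B)"
        using m(1) unfolding Measure_Space.additive_def by auto
      then show ?thesis
        using m'A[OF satU[OF F(1,2)]] m'A[OF sat[OF F(1)]] m'A[OF sat[OF F(2)]]
        by (simp add: T_def AB image_Un)
    qed
    ultimately show ?thesis using Q0 by auto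
  qed
  ultimately have "S \<inter> \<Inter> (T ` Q) \<noteq> {}"
    by (metis (no_types, lifting) compact_imp_fip imageE)
  then obtain m where m: "m \<in> S" "\<And>q. q \<in> Q \<Longrightarrow> m \<in> T q" by auto
  have "Measure_Space.additive \<F> m"
    unfolding Measure_Space.additive_def
  proof (intro ballI impI)
    fix A B assume "A \<in> \<F>" "B \<in> \<F>" "A \<inter> B = {}"
    then have "m \<in> T (A, B)" by (intro m(2)) (simp add: Q_def)
    then show "m (A \<union> B) = m A + m B" by (simp add: T_def)
  qed
  moreover have "norm (\<nu> A - m A) \<le> c" for A
  proof -
    have "m A \<in> I A" using m(1) by (simp add: S_def PiE_iff)
    then show ?thesis by (simp add: I_def abs_le_iff)
  qed
  ultimately show "\<exists>\<mu>. Measure_Space.additive \<F> \<mu> \<and> (\<forall>A\<in>\<F>. norm (\<nu> A - \<mu> A) \<le> c)" by blast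
qed

subsection \<open>Banach spaces\<close>

context normed_space_on
begin

lemma zero_add: "x \<in> carr E \<Longrightarrow> vadd E (vzero E) x = x"
  using add_commute add_zero zero_closed by metis

lemma scale_zero_left:
  assumes x: "x \<in> carr E" shows "vscale E 0 x = vzero E"
proof -
  have "vscale E 0 x = vadd E (vscale E 1 x) (vscale E (-1) x)"
    using add_scale[OF x, of 1 "-1"] by simp
  then show ?thesis using x by (simp add: scale_one add_inverse)
qed

lemma norm_zero: "vnorm E (vzero E) = 0"
  using norm_eq_zero zero_closed by blast

lemma norm_minus: "x \<in> carr E \<Longrightarrow> vnorm E (vscale E (-1) x) = vnorm E x"
  by (simp add: norm_scale)

lemma norm_nonneg:
  assumes x: "x \<in> carr E" shows "0 \<le> vnorm E x"
proof -
  have "vnorm E (vadd E x (vscale E (-1) x)) \<le> vnorm E x + vnorm E (vscale E (-1) x)"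
    by (intro norm_triangle x scale_closed)
  then show ?thesis using x by (simp add: add_inverse norm_zero norm_minus)
qed

abbreviation (input) sub :: "'e \<Rightarrow> 'e \<Rightarrow> 'e" where "sub x y \<equiv> vadd E x (vscale E (-1) y)"

lemma sub_closed: "\<lbrakk>x \<in> carr E; y \<in> carr E\<rbrakk> \<Longrightarrow> sub x y \<in> carr E"
  by (simp add: add_closed scale_closed)

lemma sub_add_sub:
  assumes "x \<in> carr E" "y \<in> carr E" "z \<in> carr E"
  shows "vadd E (sub x y) (sub y z) = sub x z"
proof -
  have "vadd E (sub x y) (sub y z) = vadd E x (vadd E (vscale E (-1) y) (sub y z))"
    using assms by (simp add: add_assoc add_closed scale_closed)
  also have "vadd E (vscale E (-1) y) (sub y z) = vadd E (sub y y) (vscale E (-1) z)"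
    using assms by (simp add: add_assoc[symmetric] add_commute[of "vscale E (-1) y" y] scale_closed)
  finally show ?thesis using assms by (simp add: add_inverse zero_add scale_closed)
qed

lemma sub_commute:
  assumes "x \<in> carr E" "y \<in> carr E"
  shows "vscale E (-1) (sub x y) = sub y x"
  using assms by (simp add: scale_add scale_closed scale_scale scale_one add_commute)

lemma Metric_space: "Metric_space (carr E) (vdist E)"
proof
  show "0 \<le> vdist E x y" for x y
    by (simp add: vdist_def norm_nonneg sub_closed)
  show "vdist E x y = vdist E y x" for x y
  proof (cases "x \<in> carr E \<and> y \<in> carr E")
    case True
    then show ?thesis
      using norm_minus[OF sub_closed[of x y]] by (simp add: vdist_def sub_commute)
  qed (auto simp: vdist_def)
  show "vdist E x y = 0 \<longleftrightarrow> x = y" if "x \<in> carr E" "y \<in> carr E" for x y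
  proof
    assume "vdist E x y = 0"
    then have *: "sub x y = vzero E" using that by (simp add: vdist_def norm_eq_zero sub_closed)
    have "x = vadd E x (vadd E (vscale E (-1) y) y)"
      using that by (simp add: add_commute[of _ y] add_inverse add_zero scale_closed)
    also have "\<dots> = vadd E (sub x y) y" using that by (simp add: add_assoc scale_closed)
    finally show "x = y" using that * by (simp add: zero_add)
  qed (use that in \<open>simp add: vdist_def add_inverse norm_zero\<close>)
  show "vdist E x z \<le> vdist E x y + vdist E y z"
    if "x \<in> carr E" "y \<in> carr E" "z \<in> carr E" for x y z
    using norm_triangle[OF sub_closed[of x y] sub_closed[of y z]] that
    by (simp add: vdist_def sub_add_sub)
qed

lemma density_imp_inj:
  fixes \<kappa> :: "'k rel"
  assumes "Card_order \<kappa>" "density_character_less E \<kappa>"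
  obtains i :: "'e \<Rightarrow> (nat \<Rightarrow> 'k)" where "inj_on i (carr E)"
proof -
  interpret M: Metric_space "carr E" "vdist E" by (rule Metric_space)
  obtain D where D: "D \<subseteq> carr E" "M.mtopology closure_of D = carr E" "|D| <o \<kappa>"
    using assms(2) unfolding density_character_less_def by blast
  obtain g :: "'e \<Rightarrow> 'k" where g: "inj_on g D" using ordLess_imp_inj assms(1) D(3) by blast
  have "\<exists>y. y \<in> D \<and> vdist E x y < 1 / Suc n" if "x \<in> carr E" for x n
  proof -
    have "x \<in> M.mtopology closure_of D" using that D(2) by simp
    then have "\<exists>y\<in>D. y \<in> M.mball x (1 / Suc n)" unfolding M.metric_closure_of by simp
    then show ?thesis unfolding M.in_mball by blast
  qed
  then obtain s where s: "\<And>x n. x \<in> carr E \<Longrightarrow> s x n \<in> D \<and> vdist E x (s x n) < 1 / Suc n"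
    by metis
  have "inj_on (\<lambda>x n. g (s x n)) (carr E)"
  proof (rule inj_onI)
    fix x y assume xy: "x \<in> carr E" "y \<in> carr E" and eq: "(\<lambda>n. g (s x n)) = (\<lambda>n. g (s y n))"
    have s_eq: "s x n = s y n" for n
      using fun_cong[OF eq, of n] s[OF xy(1), of n] s[OF xy(2), of n] g by (auto dest: inj_onD)
    have "vdist E x y = 0"
    proof (rule ccontr)
      assume "vdist E x y \<noteq> 0"
      then have "0 < vdist E x y / 2" using M.nonneg[of x y] by linarith
      then obtain n where n: "1 / Suc n < vdist E x y / 2"
        using nat_approx_posE by blast
      have "vdist E x y \<le> vdist E x (s x n) + vdist E (s x n) y"
        using xy s D(1) by (intro M.triangle) auto
      also have "vdist E (s x n) y = vdist E y (s y n)" by (simp add: s_eq M.commute)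
      finally show False using s[OF xy(1), of n] s[OF xy(2), of n] n by linarith
    qed
    then show "x = y" using xy by simp
  qed
  then show thesis by (rule that)
qed

end

definition image_space :: "'e nspace \<Rightarrow> ('e \<Rightarrow> 'f) \<Rightarrow> 'f nspace" where
  "image_space E i =
     (let j = the_inv_into (carr E) i in
      \<lparr>carr = i ` carr E, vadd = \<lambda>a b. i (vadd E (j a) (j b)), vzero = i (vzero E),
       vscale = \<lambda>r a. i (vscale E r (j a)), vnorm = \<lambda>a. vnorm E (j a)\<rparr>)"

locale space_transport = normed_space_on E for E :: "'e nspace" (structure) +
  fixes i :: "'e \<Rightarrow> 'f"
  assumes inj: "inj_on i (carr E)"
begin

abbreviation "j \<equiv> the_inv_into (carr E) i"
abbreviation "E' \<equiv> image_space E i"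

lemma ji [simp]: "x \<in> carr E \<Longrightarrow> j (i x) = x"
  by (simp add: inj the_inv_into_f_f)

lemma sel [simp]:
  "carr E' = i ` carr E" "vzero E' = i (vzero E)"
  "\<lbrakk>x \<in> carr E; y \<in> carr E\<rbrakk> \<Longrightarrow> vadd E' (i x) (i y) = i (vadd E x y)"
  "x \<in> carr E \<Longrightarrow> vscale E' a (i x) = i (vscale E a x)"
  "x \<in> carr E \<Longrightarrow> vnorm E' (i x) = vnorm E x"
  by (simp_all add: image_space_def Let_def)

lemma i_eq: "\<lbrakk>x \<in> carr E; y \<in> carr E\<rbrakk> \<Longrightarrow> i x = i y \<longleftrightarrow> x = y"
  using inj by (auto dest: inj_onD)

lemma normed_E': "normed_space_on E'"
  by unfold_locales
     (auto simp: zero_closed add_closed scale_closed add_assoc add_zero add_inverse scale_add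
        add_scale scale_scale scale_one norm_eq_zero norm_triangle norm_scale i_eq intro: add_commute)

sublocale E': normed_space_on E' by (rule normed_E')
sublocale M: Metric_space "carr E" "vdist E" by (rule Metric_space)
sublocale M': Metric_space "carr E'" "vdist E'" by (rule E'.Metric_space)

lemma dist_i [simp]: "\<lbrakk>x \<in> carr E; y \<in> carr E\<rbrakk> \<Longrightarrow> vdist E' (i x) (i y) = vdist E x y"
  by (simp add: vdist_def add_closed scale_closed)

lemma limit_i:
  assumes "range s \<subseteq> carr E" "l \<in> carr E"
  shows "limitin M'.mtopology (i \<circ> s) (i l) sequentially \<longleftrightarrow> limitin M.mtopology s l sequentially"
proof -
  have "s n \<in> carr E" for n using assms(1) by auto
  then show ?thesis
    unfolding M.limit_metric_sequentially M'.limit_metric_sequentially using assms(2) by simp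
qed

lemma seq_lift:
  assumes "range u \<subseteq> i ` A" "A \<subseteq> carr E"
  obtains s where "range s \<subseteq> A" "u = i \<circ> s"
proof
  show "range (j \<circ> u) \<subseteq> A" using assms by (auto simp: subset_iff image_iff) (metis ji)
  show "u = i \<circ> (j \<circ> u)"
  proof
    fix n
    obtain x where "x \<in> A" "u n = i x" using assms(1) by auto
    then show "u n = (i \<circ> (j \<circ> u)) n" using assms(2) by auto
  qed
qed

lemma Banach_E': assumes "Banach_space_on E" shows "Banach_space_on E'"
  unfolding Banach_space_on_def
proof (intro conjI normed_E')
  show "M'.mcomplete"
    unfolding M'.mcomplete_def
  proof (intro allI impI)
    fix u assume u: "M'.MCauchy u"
    then have "range u \<subseteq> i ` carr E" unfolding M'.MCauchy_def by simp
    then obtain s where s: "range s \<subseteq> carr E" "u = i \<circ> s" by (rule seq_lift) auto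
    then have "s n \<in> carr E" for n by auto
    then have "M.MCauchy s" using u s unfolding M'.MCauchy_def M.MCauchy_def by simp
    then obtain l where l: "limitin M.mtopology s l sequentially"
      using assms unfolding Banach_space_on_def M.mcomplete_def by blast
    then have "l \<in> carr E" by (simp add: M.limit_metric_sequentially)
    then show "\<exists>x. limitin M'.mtopology u x sequentially" using l limit_i s by blast
  qed
qed

lemma density_E':
  assumes "density_character_less E \<kappa>" shows "density_character_less E' \<kappa>"
proof -
  obtain D where D: "D \<subseteq> carr E" "M.mtopology closure_of D = carr E" "|D| <o \<kappa>"
    using assms unfolding density_character_less_def by blast
  have "\<exists>y\<in>D. vdist E x y < r" if "x \<in> carr E" "0 < r" for x r
  proof -
    have "x \<in> M.mtopology closure_of D" using that D(2) by simp
    then show ?thesis using that unfolding M.metric_closure_of by (auto simp: M.in_mball)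
  qed
  then have "\<exists>y\<in>D. vdist E' (i x) (i y) < r" if "x \<in> carr E" "0 < r" for x r
    using that D(1) by (metis dist_i subsetD)
  then have "M'.mtopology closure_of (i ` D) = carr E'"
    unfolding M'.metric_closure_of M'.in_mball using D(1) by auto blast?
  moreover have "|i ` D| <o \<kappa>" using card_of_image D(3) by (rule ordLeq_ordLess_trans)
  moreover have "i ` D \<subseteq> carr E'" using D(1) by auto
  ultimately show ?thesis unfolding density_character_less_def by blast
qed

lemma closed_subspace_E':
  assumes "closed_subspace E F" shows "closed_subspace E' (i ` F)"
proof -
  have F: "F \<subseteq> carr E" "vzero E \<in> F" "\<And>x y. \<lbrakk>x \<in> F; y \<in> F\<rbrakk> \<Longrightarrow> vadd E x y \<in> F"
    "\<And>a x. x \<in> F \<Longrightarrow> vscale E a x \<in> F" "closedin M.mtopology F"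
    using assms unfolding closed_subspace_def by auto
  have "closedin M'.mtopology (i ` F)"
    unfolding M'.metric_closedin_iff_sequentially_closed
  proof (intro conjI allI impI; (elim conjE)?)
    show "i ` F \<subseteq> carr E'" using F(1) by auto
    fix u l assume u: "range u \<subseteq> i ` F" and l: "limitin M'.mtopology u l sequentially"
    obtain s where s: "range s \<subseteq> F" "u = i \<circ> s" using seq_lift u F(1) by blast
    obtain x where x: "x \<in> carr E" "l = i x"
      using l unfolding M'.limit_metric_sequentially by auto
    have "limitin M.mtopology s x sequentially" using limit_i[of s x] s F(1) l x by auto
    then have "x \<in> F" using F(5) s(1) unfolding M.metric_closedin_iff_sequentially_closed by blast
    then show "l \<in> i ` F" using x by simp
  qed
  moreover have "x \<in> carr E" if "x \<in> F" for x using that F(1) by auto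
  ultimately show ?thesis unfolding closed_subspace_def using F(2-4) by auto
qed

lemma bounded_operator_E':
  fixes t :: "'e \<Rightarrow> 'x::real_normed_vector"
  assumes "closed_subspace E F" "bounded_operator E F t"
  shows "bounded_operator E' (i ` F) (t \<circ> j)"
proof -
  have F: "\<And>x. x \<in> F \<Longrightarrow> x \<in> carr E"
    "\<And>x y. \<lbrakk>x \<in> F; y \<in> F\<rbrakk> \<Longrightarrow> vadd E x y \<in> F" "\<And>a x. x \<in> F \<Longrightarrow> vscale E a x \<in> F"
    using assms(1) unfolding closed_subspace_def by auto
  show ?thesis using assms(2) unfolding bounded_operator_def by (simp add: F)
qed

lemma bounded_operator_E:
  fixes T :: "'f \<Rightarrow> 'x::real_normed_vector"
  assumes "bounded_operator E' (carr E') T"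
  shows "bounded_operator E (carr E) (T \<circ> i)"
  using assms unfolding bounded_operator_def by simp

lemma operator_norm_E':
  fixes T :: "'f \<Rightarrow> 'x::real_normed_vector"
  assumes "F \<subseteq> carr E"
  shows "operator_norm E' (i ` F) T = operator_norm E F (T \<circ> i)"
proof -
  have "norm (T (i x)) / vnorm E' (i x) = norm ((T \<circ> i) x) / vnorm E x" if "x \<in> F" for x
    using that assms by auto
  then show ?thesis unfolding operator_norm_def image_image by (intro arg_cong[where f=Sup] image_cong refl)
qed

lemma operator_norm_j:
  fixes t :: "'e \<Rightarrow> 'x::real_normed_vector"
  assumes "F \<subseteq> carr E"
  shows "operator_norm E' (i ` F) (t \<circ> j) = operator_norm E F t"
proof -
  have "norm ((t \<circ> j \<circ> i) x) / vnorm E x = norm (t x) / vnorm E x" if "x \<in> F" for x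
    using that assms by auto
  then have "operator_norm E F (t \<circ> j \<circ> i) = operator_norm E F t"
    unfolding operator_norm_def by (intro arg_cong[where f=Sup] image_cong refl)
  then show ?thesis by (simp add: operator_norm_E'[OF assms])
qed

end

theorem cardinal_injective_any_space:
  fixes \<kappa> :: "'k rel" and E :: "'e nspace" and t :: "'e \<Rightarrow> 'x::banach"
  assumes \<kappa>: "Card_order \<kappa>" and hyp: "cardinal_injective \<kappa> TYPE('x)"
    and E: "Banach_space_on E" "density_character_less E \<kappa>"
    and F: "closed_subspace E F" and t: "bounded_operator E F t"
  shows "\<exists>T. bounded_operator E (carr E) T \<and> (\<forall>x\<in>F. T x = t x)"
proof -
  interpret normed_space_on E using E(1) by (simp add: Banach_space_on_def)
  obtain i :: "'e \<Rightarrow> nat \<Rightarrow> 'k" where i: "inj_on i (carr E)" using density_imp_inj \<kappa> E(2) by blast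
  interpret space_transport E i by unfold_locales (rule i)
  have sub: "F \<subseteq> carr E" using F by (simp add: closed_subspace_def)
  obtain T where T: "bounded_operator E' (carr E') T" "\<And>x. x \<in> i ` F \<Longrightarrow> T x = (t \<circ> j) x"
    using hyp[unfolded cardinal_injective_def, rule_format, of E' "i ` F" "t \<circ> j"]
      Banach_E' density_E' closed_subspace_E' bounded_operator_E' E F t by blast
  have "(T \<circ> i) x = t x" if "x \<in> F" for x using T(2)[of "i x"] that sub by auto
  then show ?thesis using bounded_operator_E[OF T(1)] by blast
qed

theorem lambda_injective_any_space:
  fixes \<kappa> :: "'k rel" and E :: "'e nspace" and t :: "'e \<Rightarrow> 'x::banach"
  assumes \<kappa>: "Card_order \<kappa>" and hyp: "lambda_injective l \<kappa> TYPE('x)"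
    and E: "Banach_space_on E" "density_character_less E \<kappa>"
    and F: "closed_subspace E F" and t: "bounded_operator E F t"
  shows "\<exists>T. bounded_operator E (carr E) T \<and> (\<forall>x\<in>F. T x = t x) \<and>
           operator_norm E (carr E) T \<le> l * operator_norm E F t"
proof -
  interpret normed_space_on E using E(1) by (simp add: Banach_space_on_def)
  obtain i :: "'e \<Rightarrow> nat \<Rightarrow> 'k" where i: "inj_on i (carr E)" using density_imp_inj \<kappa> E(2) by blast
  interpret space_transport E i by unfold_locales (rule i)
  have sub: "F \<subseteq> carr E" using F by (simp add: closed_subspace_def)
  obtain T where T: "bounded_operator E' (carr E') T" "\<And>x. x \<in> i ` F \<Longrightarrow> T x = (t \<circ> j) x"
    "operator_norm E' (carr E') T \<le> l * operator_norm E' (i ` F) (t \<circ> j)"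
    using hyp[unfolded lambda_injective_def, rule_format, of E' "i ` F" "t \<circ> j"]
      Banach_E' density_E' closed_subspace_E' bounded_operator_E' E F t by blast
  have "(T \<circ> i) x = t x" if "x \<in> F" for x using T(2)[of "i x"] that sub by auto
  moreover have "operator_norm E (carr E) (T \<circ> i) \<le> l * operator_norm E F t"
    using T(3) operator_norm_E'[of "carr E" T] operator_norm_j[OF sub, of t] by simp
  ultimately show ?thesis using bounded_operator_E[OF T(1)] by blast
qed

end

theory Submission
  imports Defs "HOL-Library.Function_Algebras" "HOL-Probability.Discrete_Topology"
begin

text \<open>
  Let \<open>\<nu>\<close> be a 1-additive map into \<open>X\<close>.  Norming functionals embed \<open>X\<close> isometrically, by a map
  \<open>J\<close>, into the bounded functions on a discrete space; applying the scalar theorem to every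
  coordinate of \<open>J \<circ> \<nu>\<close> gives a vector measure \<open>\<mu>\<close> with values in that larger space and
  \<open>\<parallel>J (\<nu> A) - \<mu> A\<parallel> \<le> K\<close>.  The closed span \<open>Z\<close> of the values of \<open>J \<circ> \<nu>\<close> and \<open>\<mu>\<close> has density
  character less than \<open>\<kappa>\<close>, so \<open>J\<inverse>\<close> extends from \<open>Z \<inter> J X\<close> to an operator \<open>T\<close> on \<open>Z\<close>, and \<open>T \<circ> \<mu>\<close>
  is a vector measure at distance at most \<open>\<parallel>T\<parallel> K\<close> from \<open>\<nu>\<close>; this even gives \<open>\<lambda> K\<close> instead of
  \<open>24 \<lambda> K\<close>.  If no bound on \<open>\<parallel>T\<parallel>\<close> is given, apply this to countably many maps at once, with a
  common \<open>Z\<close>; that is where the cofinality of \<open>\<kappa>\<close> enters.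

  The finiteness of \<open>K\<close> is the Kalton--Roberts theorem.  Call two lists of \<open>m\<close> sets balanced if
  the sums of their indicator functions agree.  By a Hahn--Banach argument, \<open>f\<close> is uniformly close
  to an additive map, up to a constant, if its sums over balanced lists differ by at most
  \<open>m W\<close>.  Sets that cover every point at most half of the time can be cut up and recombined
  along a concentrator graph into fewer sets, at the cost of a bounded error per set, and this
  improves \<open>W\<close> to \<open>3/4 W + 50\<close>.
\<close>

section \<open>Additive majorised functionals\<close>

text \<open>
  The pairs \<open>(v, c)\<close> stand for constraints \<open>\<phi> v \<le> c\<close> on an additive \<open>\<phi>\<close>; consistency is the
  obvious necessary condition for solvability.  The first conjunct makes the constraints bound
  \<open>\<phi>\<close> either on both sides or on neither, in any direction \<open>v\<close>.
\<close>

definition consistent :: "('v::ab_group_add \<times> real) set \<Rightarrow> bool" where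
  "consistent S \<longleftrightarrow> (\<forall>(v, c)\<in>S. \<exists>d. (- v, d) \<in> S) \<and>
     (\<forall>xs. set xs \<subseteq> S \<and> sum_list (map fst xs) = 0 \<longrightarrow> 0 \<le> sum_list (map snd xs))"

lemma consistentD:
  "\<lbrakk>consistent S; set xs \<subseteq> S; sum_list (map fst xs) = 0\<rbrakk> \<Longrightarrow> 0 \<le> sum_list (map snd xs)"
  unfolding consistent_def by blast

section \<open>Additive functionals under consistent constraints, by one-step extension and Zorn's
  lemma\<close>

abbreviation nmult :: "nat \<Rightarrow> 'v::ab_group_add \<Rightarrow> 'v" where
  "nmult n v \<equiv> sum_list (replicate n v)"

lemma nmult_add: "nmult (m + n) v = nmult m v + nmult n v"
  by (simp add: replicate_add)

lemma nmult_minus: "nmult n (- v) = - nmult n v"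
  by (induction n) auto

lemma nmult_mult: "nmult m (nmult n v) = nmult (m * n) v"
  by (induction m) (auto simp: nmult_add)

lemma sum_list_concat_replicate:
  "sum_list (map f (concat (replicate n xs))) = nmult n (sum_list (map f xs))"
  by (induction n) auto

lemma nmult_real: "nmult n (c::real) = n * c"
  by (simp add: sum_list_replicate)

text \<open>Hahn-Banach step for groups: a list of constraints summing to a positive multiple of
  \<open>v\<close> bounds \<open>\<phi> v\<close> from above, one summing to a negative multiple
  bounds it from below. Any real between all lower and all upper bounds may be prescribed as the
  value at \<open>v\<close>.\<close>

lemma consistent_Un:
  assumes "consistent S"
  obtains c where "consistent (insert (v, c) (insert (- v, - c) S))"
proof -
  define U where "U = {sum_list (map snd ys) / n | ys n. 0 < n \<and> set ys \<subseteq> S \<and> sum_list (map fst ys) = nmult n v}"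
  define L where "L = {- sum_list (map snd ys) / n | ys n. 0 < n \<and> set ys \<subseteq> S \<and> sum_list (map fst ys) = - nmult n v}"
  have sep: "l \<le> u" if "l \<in> L" "u \<in> U" for l u
  proof -
    obtain ys m where y: "0 < m" "set ys \<subseteq> S" "sum_list (map fst ys) = - nmult m v" "l = - sum_list (map snd ys) / real m"
      using \<open>l \<in> L\<close> unfolding L_def by auto
    obtain zs n where z: "0 < n" "set zs \<subseteq> S" "sum_list (map fst zs) = nmult n v" "u = sum_list (map snd zs) / real n"
      using \<open>u \<in> U\<close> unfolding U_def by auto
    \<comment> \<open>Repeating each list as often as the multiplicity of the other one demands
      cancels the multiples of \<open>v\<close>.\<close>
    let ?w = "concat (replicate n ys) @ concat (replicate m zs)"
    have "sum_list (map fst ?w) = 0"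
      by (simp add: sum_list_concat_replicate y z nmult_minus nmult_mult mult.commute)
    moreover have "set ?w \<subseteq> S" using y z by auto
    ultimately have "0 \<le> sum_list (map snd ?w)" using consistentD assms by blast
    then have "0 \<le> n * sum_list (map snd ys) + m * sum_list (map snd zs)"
      by (simp add: sum_list_concat_replicate nmult_real)
    then have "- (m * sum_list (map snd zs)) \<le> n * sum_list (map snd ys)" by simp
    then show ?thesis unfolding y(4) z(4) using y(1) z(1) frac_le_eq[of m n "- sum_list (map snd ys)" "sum_list (map snd zs)"]
      by (simp add: divide_le_0_iff mult.commute)
  qed
  \<comment> \<open>By the symmetry in the definition of consistency, \<open>U\<close> and
    \<open>L\<close> are empty together. If both are, any \<open>c\<close> will do; otherwise
    \<open>Sup L\<close> exists and lies between them.\<close>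
  have neg: "\<exists>zs. set zs \<subseteq> S \<and> sum_list (map fst zs) = - sum_list (map fst ys)" if "set ys \<subseteq> S" for ys
    using that
  proof (induction ys)
    case (Cons y ys)
    then obtain zs where zs: "set zs \<subseteq> S" "sum_list (map fst zs) = - sum_list (map fst ys)" by auto
    obtain d where "(- fst y, d) \<in> S" using Cons.prems assms unfolding consistent_def by (cases y) auto
    then show ?case using zs by (intro exI[of _ "(- fst y, d) # zs"]) auto
  qed (auto intro: exI[of _ "[]"])
  have ne: "L \<noteq> {} \<longleftrightarrow> U \<noteq> {}"
  proof
    assume "L \<noteq> {}"
    then obtain ys n where "0 < n" "set ys \<subseteq> S" "sum_list (map fst ys) = - nmult n v" unfolding L_def by auto
    moreover obtain zs where "set zs \<subseteq> S" "sum_list (map fst zs) = - sum_list (map fst ys)"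
      using neg calculation(2) by blast
    ultimately have "sum_list (map snd zs) / n \<in> U" unfolding U_def by auto
    then show "U \<noteq> {}" by blast
  next
    assume "U \<noteq> {}"
    then obtain ys n where "0 < n" "set ys \<subseteq> S" "sum_list (map fst ys) = nmult n v" unfolding U_def by auto
    moreover obtain zs where "set zs \<subseteq> S" "sum_list (map fst zs) = - sum_list (map fst ys)"
      using neg calculation(2) by blast
    ultimately have "- sum_list (map snd zs) / n \<in> L" unfolding L_def by auto
    then show "L \<noteq> {}" by blast
  qed
  obtain c where c: "\<And>l. l \<in> L \<Longrightarrow> l \<le> c" "\<And>u. u \<in> U \<Longrightarrow> c \<le> u"
  proof (cases "U = {}")
    case True
    then show ?thesis using ne that[of 0] by auto
  next
    case False
    then obtain u where "u \<in> U" by blast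
    then have "bdd_above L" using sep by (intro bdd_aboveI)
    then show ?thesis using False ne that[of "Sup L"] sep by (auto intro: cSup_upper cSup_least)
  qed
  let ?S = "insert (v, c) (insert (- v, - c) S)"
  \<comment> \<open>The new constraints contribute only their net multiplicity \<open>a - b\<close>.
    Its sign decides whether the upper or the lower bound on \<open>c\<close> is needed.\<close>
  have decomp: "\<exists>ys a b. set ys \<subseteq> S \<and> sum_list (map fst xs) = sum_list (map fst ys) + nmult a v - nmult b v
      \<and> sum_list (map snd xs) = sum_list (map snd ys) + (real a - real b) * c" if "set xs \<subseteq> ?S" for xs
    using that
  proof (induction xs)
    case Nil then show ?case by (intro exI[of _ "[]"] exI[of _ 0]) auto
  next
    case (Cons x xs)
    then obtain ys a b where IH: "set ys \<subseteq> S" "sum_list (map fst xs) = sum_list (map fst ys) + nmult a v - nmult b v"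
      "sum_list (map snd xs) = sum_list (map snd ys) + (real a - real b) * c" by auto
    consider "x = (v, c)" | "x = (- v, - c)" | "x \<in> S" using Cons.prems by auto
    then show ?case
    proof cases
      case 1 then show ?thesis using IH by (intro exI[of _ ys] exI[of _ "Suc a"] exI[of _ b]) (auto simp: algebra_simps)
    next
      case 2 then show ?thesis using IH by (intro exI[of _ ys] exI[of _ a] exI[of _ "Suc b"]) (auto simp: algebra_simps)
    next
      case 3 then show ?thesis using IH by (intro exI[of _ "x # ys"] exI[of _ a] exI[of _ b]) (auto simp: algebra_simps)
    qed
  qed
  have "consistent ?S"
    unfolding consistent_def
  proof (intro conjI allI impI)
    show "\<forall>(w, e)\<in>?S. \<exists>d. (- w, d) \<in> ?S" using assms unfolding consistent_def by fastforce
    fix xs assume "set xs \<subseteq> ?S \<and> sum_list (map fst xs) = 0"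
    then obtain ys a b where ys: "set ys \<subseteq> S" "sum_list (map fst ys) + nmult a v - nmult b v = 0"
      and s: "sum_list (map snd xs) = sum_list (map snd ys) + (real a - real b) * c" using decomp by metis
    consider "a = b" | "a < b" | "b < a" by linarith
    then show "0 \<le> sum_list (map snd xs)"
    proof cases
      case 1 then show ?thesis using consistentD[OF assms ys(1)] ys(2) s by simp
    next
      case 2
      then obtain k where k: "b = a + k" "0 < k" using less_imp_add_positive by blast
      then have "sum_list (map fst ys) = nmult k v" using ys(2) by (simp add: nmult_add algebra_simps)
      then have "sum_list (map snd ys) / k \<in> U" unfolding U_def using k ys(1) by blast
      then have "c \<le> sum_list (map snd ys) / k" by (rule c)
      then show ?thesis using s k by (simp add: field_simps)
    next
      case 3
      then obtain k where k: "a = b + k" "0 < k" using less_imp_add_positive by blast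
      then have "sum_list (map fst ys) = - nmult k v" using ys(2) by (simp add: nmult_add eq_neg_iff_add_eq_0)
      then have "- sum_list (map snd ys) / k \<in> L" unfolding L_def using k ys(1) by blast
      then have "- sum_list (map snd ys) / k \<le> c" by (rule c)
      then show ?thesis using s k by (simp add: field_simps)
    qed
  qed
  then show thesis by (rule that)
qed

text \<open>In a maximal consistent set, \<open>consistent_Un\<close> forces every \<open>v\<close>
  to occur in a pair \<open>(v, c)\<close>, \<open>(- v, - c)\<close>; this \<open>c\<close> is the
  value of the functional. Additivity and the bounds are then consistency of lists of length three
  and two.\<close>

lemma consistent_imp_additive:
  assumes "consistent S"
  obtains \<phi> :: "'v::ab_group_add \<Rightarrow> real"
    where "\<And>x y. \<phi> (x + y) = \<phi> x + \<phi> y" "\<And>v c. (v, c) \<in> S \<Longrightarrow> \<phi> v \<le> c"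
proof -
  let ?\<S> = "{R. S \<subseteq> R \<and> consistent R}"
  have chains: "\<Union>\<C> \<in> ?\<S>" if ne: "\<C> \<noteq> {}" and ch: "subset.chain ?\<S> \<C>" for \<C>
  proof -
    have C: "\<And>R. R \<in> \<C> \<Longrightarrow> S \<subseteq> R \<and> consistent R" using ch by (auto simp: subset.chain_def)
    have "consistent (\<Union>\<C>)"
      unfolding consistent_def
    proof (intro conjI allI impI)
      show "\<forall>(v, c)\<in>\<Union>\<C>. \<exists>d. (- v, d) \<in> \<Union>\<C>"
        using C unfolding consistent_def by fastforce
      fix xs assume xs: "set xs \<subseteq> \<Union>\<C> \<and> sum_list (map fst xs) = 0"
      obtain R where "R \<in> \<C>" "set xs \<subseteq> R"
        using finite_subset_Union_chain[OF _ _ ne ch, of "set xs"] xs by auto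
      then show "0 \<le> sum_list (map snd xs)" using C xs consistentD by blast
    qed
    then show ?thesis using ne C by blast
  qed
  obtain R where R: "S \<subseteq> R" "consistent R" and max: "\<And>R'. \<lbrakk>R \<subseteq> R'; consistent R'\<rbrakk> \<Longrightarrow> R' = R"
  proof -
    have "\<exists>M\<in>?\<S>. \<forall>X\<in>?\<S>. M \<subseteq> X \<longrightarrow> X = M"
      by (rule subset_Zorn_nonempty) (use assms chains in blast)+
    then obtain M where M: "M \<in> ?\<S>" "\<forall>X\<in>?\<S>. M \<subseteq> X \<longrightarrow> X = M" by (rule bexE)
    show ?thesis
    proof (rule that)
      show "R' = M" if "M \<subseteq> R'" "consistent R'" for R'
        using M that by auto
    qed (use M in auto)
  qed
  have "\<exists>c. (v, c) \<in> R \<and> (- v, - c) \<in> R" for v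
  proof -
    obtain c where c: "consistent (insert (v, c) (insert (- v, - c) R))" by (rule consistent_Un[OF R(2)])
    have "insert (v, c) (insert (- v, - c) R) = R" by (rule max[OF _ c]) auto
    then show ?thesis by (intro exI[of _ c]) auto
  qed
  then obtain \<phi> where \<phi>: "\<And>v. (v, \<phi> v) \<in> R \<and> (- v, - \<phi> v) \<in> R"
    by metis
  show thesis
  proof
    fix x y
    have "0 \<le> sum_list (map snd [(x, \<phi> x), (y, \<phi> y), (- (x + y), - \<phi> (x + y))])"
      using \<phi>[of x] \<phi>[of y] \<phi>[of "x + y"] by (intro consistentD[OF R(2)]) auto
    moreover have "0 \<le> sum_list (map snd [(- x, - \<phi> x), (- y, - \<phi> y), (x + y, \<phi> (x + y))])"
      using \<phi>[of x] \<phi>[of y] \<phi>[of "x + y"] by (intro consistentD[OF R(2)]) auto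
    ultimately show "\<phi> (x + y) = \<phi> x + \<phi> y" by simp
  next
    fix v c assume "(v, c) \<in> S"
    then have "0 \<le> sum_list (map snd [(v, c), (- v, - \<phi> v)])"
      using \<phi> R(1) by (intro consistentD[OF R(2)]) auto
    then show "\<phi> v \<le> c" by simp
  qed
qed

text \<open>With the norm as majorant, \<open>consistent_imp_additive\<close> gives an additive
  functional only; homogeneity over the reals follows from its bound by the norm.\<close>

lemma norming_functional:
  fixes x :: "'x::real_normed_vector"
  obtains \<phi> :: "'x \<Rightarrow> real" where "linear \<phi>" "\<And>y. \<bar>\<phi> y\<bar> \<le> norm y" "\<phi> x = norm x"
proof -
  \<comment> \<open>The additional constraint forces \<open>\<phi> x = norm x\<close>.\<close>
  let ?S = "insert (- x, - norm x) (range (\<lambda>y. (y, norm y)))"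
  \<comment> \<open>\<open>n\<close> counts the uses of the extra constraint; each adds
    \<open>x\<close> back and costs \<open>norm x\<close>, and the triangle inequality absorbs the
    other constraints.\<close>
  have decomp: "\<exists>n. sum_list (map snd xs) \<ge> norm (sum_list (map fst xs) + nmult n x) - n * norm x"
    if "set xs \<subseteq> ?S" for xs
    using that
  proof (induction xs)
    case Nil then show ?case by (intro exI[of _ 0]) auto
  next
    case (Cons z xs)
    then obtain n where n: "sum_list (map snd xs) \<ge> norm (sum_list (map fst xs) + nmult n x) - n * norm x" by auto
    consider "z = (- x, - norm x)" | y where "z = (y, norm y)" using Cons.prems by auto
    then show ?case
    proof cases
      case 1 then show ?thesis using n by (intro exI[of _ "Suc n"]) (auto simp: algebra_simps)
    next
      case 2
      then show ?thesis using n norm_triangle_ineq[of y "sum_list (map fst xs) + nmult n x"]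
        by (intro exI[of _ n]) (auto simp: algebra_simps)
    qed
  qed
  have "consistent ?S"
    unfolding consistent_def
  proof (intro conjI allI impI)
    fix xs assume xs: "set xs \<subseteq> ?S \<and> sum_list (map fst xs) = 0"
    then obtain n where "sum_list (map snd xs) \<ge> norm (nmult n x) - n * norm x" using decomp[of xs] by auto
    moreover have "nmult n x = real n *\<^sub>R x" by (induction n) (auto simp: algebra_simps)
    ultimately show "0 \<le> sum_list (map snd xs)" by simp
  qed auto
  then obtain \<phi> where add: "\<And>x y. \<phi> (x + y) = \<phi> x + \<phi> y" and le: "\<And>v c. (v, c) \<in> ?S \<Longrightarrow> \<phi> v \<le> c"
    using consistent_imp_additive by blast
  interpret additive \<phi> by unfold_locales (rule add)
  have bd: "\<bar>\<phi> y\<bar> \<le> norm y" for y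
  proof -
    have "(y, norm y) \<in> ?S" "(- y, norm (- y)) \<in> ?S" by blast+
    then show ?thesis using le[of y "norm y"] le[of "- y" "norm (- y)"] by (simp add: minus abs_le_iff)
  qed
  have nat: "\<phi> (real n *\<^sub>R y) = n * \<phi> y" for n y
    by (induction n) (auto simp: zero add algebra_simps)
  have int: "\<phi> (real_of_int k *\<^sub>R y) = k * \<phi> y" for k y
    by (cases k rule: int_cases2) (auto simp: nat minus)
  \<comment> \<open>Homogeneity: after replacing \<open>n * a\<close> by its integer part, the
    remainders on both sides are at most \<open>norm y\<close>. So \<open>n\<close> times the defect
    stays bounded for all \<open>n\<close>, and the defect is zero.\<close>
  have "\<phi> (a *\<^sub>R y) = a * \<phi> y" for a y
  proof -
    have "real n * \<bar>\<phi> (a *\<^sub>R y) - a * \<phi> y\<bar> \<le> 2 * norm y" for n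
    proof -
      define k where "k = \<lfloor>n * a\<rfloor>"
      have k: "\<bar>n * a - k\<bar> \<le> 1" unfolding k_def by linarith
      have "(real n * a) *\<^sub>R y = (n * a - k) *\<^sub>R y + real_of_int k *\<^sub>R y" by (simp add: algebra_simps)
      then have "n * \<phi> (a *\<^sub>R y) = \<phi> ((n * a - k) *\<^sub>R y) + k * \<phi> y"
        using nat[of n "a *\<^sub>R y"] add int by (metis scaleR_scaleR)
      then have "n * (\<phi> (a *\<^sub>R y) - a * \<phi> y) = \<phi> ((n * a - k) *\<^sub>R y) - (n * a - k) * \<phi> y"
        by (simp add: algebra_simps)
      also have "\<bar>\<dots>\<bar> \<le> \<bar>n * a - k\<bar> * norm y + \<bar>n * a - k\<bar> * norm y"
        using bd[of "(n * a - k) *\<^sub>R y"] mult_left_mono[OF bd[of y], of "\<bar>n * a - k\<bar>"]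
        by (intro order_trans[OF abs_triangle_ineq4] add_mono) (simp_all add: abs_mult)
      also have "\<dots> \<le> 2 * norm y" using mult_right_mono[OF k, of "norm y"] by (simp add: mult.commute)
      finally show ?thesis by (simp add: abs_mult)
    qed
    then have "\<not> 0 < \<bar>\<phi> (a *\<^sub>R y) - a * \<phi> y\<bar>"
      using reals_Archimedean3[of "\<bar>\<phi> (a *\<^sub>R y) - a * \<phi> y\<bar>"] by (metis not_less)
    then show ?thesis by simp
  qed
  then have "linear \<phi>" by (intro linearI add) simp
  moreover have "\<phi> x = norm x" using le[of "- x" "- norm x"] bd[of x] by (simp add: minus)
  ultimately show thesis using that bd by blast
qed

section \<open>Concentrators\<close>

text \<open>Hall's marriage theorem by induction on \<open>card X\<close>. If some proper nonempty
  \<open>Y\<close> is tight, \<open>Y\<close> and its complement are matched separately, the latter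
  outside the neighbours of \<open>Y\<close>. Otherwise one point is matched arbitrarily, and the
  surplus of one keeps Hall's condition for the rest.\<close>

theorem Hall:
  fixes N :: "'a \<Rightarrow> 'b set"
  assumes "finite X" "\<And>i. i \<in> X \<Longrightarrow> finite (N i)"
    and "\<And>Y. Y \<subseteq> X \<Longrightarrow> card Y \<le> card (\<Union>i\<in>Y. N i)"
  shows "\<exists>\<sigma>. inj_on \<sigma> X \<and> (\<forall>i\<in>X. \<sigma> i \<in> N i)"
  using assms
proof (induction "card X" arbitrary: X N rule: less_induct)
  case less
  show ?case
  proof (cases "X = {}")
    case False
    show ?thesis
    proof (cases "\<exists>Y. Y \<subset> X \<and> Y \<noteq> {} \<and> card (\<Union>i\<in>Y. N i) = card Y")
      case True
      then obtain Y where Y: "Y \<subset> X" "Y \<noteq> {}" "card (\<Union>i\<in>Y. N i) = card Y" by blast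
      have finY: "finite Y" using Y less.prems(1) finite_subset by blast
      have "card Y < card X" using Y less.prems(1) by (simp add: psubset_card_mono)
      moreover have "\<And>i. i \<in> Y \<Longrightarrow> finite (N i)" "\<And>Z. Z \<subseteq> Y \<Longrightarrow> card Z \<le> card (\<Union>i\<in>Z. N i)"
        using Y less.prems(2,3) by auto
      ultimately obtain \<sigma>1 where 1: "inj_on \<sigma>1 Y" "\<And>i. i \<in> Y \<Longrightarrow> \<sigma>1 i \<in> N i"
        using less.hyps[of Y N] finY by blast
      define N' where "N' i = N i - (\<Union>j\<in>Y. N j)" for i
      have "card Z \<le> card (\<Union>i\<in>Z. N' i)" if Z: "Z \<subseteq> X - Y" for Z
      proof -
        have finZ: "finite Z" using Z less.prems(1) finite_subset by blast
        have "card Z + card Y = card (Z \<union> Y)"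
          using Z finZ finY by (subst card_Un_disjoint) auto
        also have "\<dots> \<le> card (\<Union>i\<in>Z \<union> Y. N i)" using Z Y by (intro less.prems(3)) auto
        also have "(\<Union>i\<in>Z \<union> Y. N i) = (\<Union>i\<in>Z. N' i) \<union> (\<Union>i\<in>Y. N i)" by (auto simp: N'_def)
        also have "card \<dots> \<le> card (\<Union>i\<in>Z. N' i) + card (\<Union>i\<in>Y. N i)" by (rule card_Un_le)
        finally show ?thesis using Y(3) by simp
      qed
      moreover have "card (X - Y) < card X"
        using Y less.prems(1) by (intro psubset_card_mono) auto
      moreover have "\<And>i. i \<in> X - Y \<Longrightarrow> finite (N' i)" using less.prems(2) by (auto simp: N'_def)
      ultimately obtain \<sigma>2 where 2: "inj_on \<sigma>2 (X - Y)" "\<And>i. i \<in> X - Y \<Longrightarrow> \<sigma>2 i \<in> N' i"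
        using less.hyps[of "X - Y" N'] less.prems(1) by blast
      define \<sigma> where "\<sigma> i = (if i \<in> Y then \<sigma>1 i else \<sigma>2 i)" for i
      have "inj_on \<sigma> X"
      proof (rule inj_onI)
        fix i j assume "i \<in> X" "j \<in> X" "\<sigma> i = \<sigma> j"
        moreover have "\<sigma>1 i \<noteq> \<sigma>2 j" if "i \<in> Y" "j \<in> X - Y" for i j
          using 1(2)[OF that(1)] 2(2)[OF that(2)] that(1) by (auto simp: N'_def)
        ultimately show "i = j"
          using inj_onD[OF 1(1), of i j] inj_onD[OF 2(1), of i j]
          by (cases "i \<in> Y"; cases "j \<in> Y") (force simp: \<sigma>_def)+
      qed
      moreover have "\<forall>i\<in>X. \<sigma> i \<in> N i" using 1 2 by (auto simp: \<sigma>_def N'_def)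
      ultimately show ?thesis by blast
    next
      case nontight: False
      obtain i where i: "i \<in> X" using False by blast
      have "N i \<noteq> {}" using less.prems(3)[of "{i}"] i by auto
      then obtain y where y: "y \<in> N i" by blast
      have "card Z \<le> card (\<Union>j\<in>Z. N j - {y})" if Z: "Z \<subseteq> X - {i}" for Z
      proof (cases "Z = {}")
        case False
        have "finite Z" using Z less.prems(1) finite_subset by blast
        then have fin: "finite (\<Union>j\<in>Z. N j)" using Z less.prems(2) by auto
        have "Z \<subset> X" using Z i by blast
        then have "card (\<Union>j\<in>Z. N j) \<noteq> card Z" using nontight False by blast
        moreover have "card Z \<le> card (\<Union>j\<in>Z. N j)" using \<open>Z \<subset> X\<close> by (intro less.prems(3)) blast
        ultimately have "card Z \<le> card (\<Union>j\<in>Z. N j) - 1" by linarith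
        also have "\<dots> \<le> card ((\<Union>j\<in>Z. N j) - {y})" using fin by (simp add: card_Diff_singleton_if)
        also have "(\<Union>j\<in>Z. N j) - {y} = (\<Union>j\<in>Z. N j - {y})" by auto
        finally show ?thesis .
      qed simp
      moreover have "card (X - {i}) < card X" using i less.prems(1) by (intro psubset_card_mono) auto
      moreover have "\<And>j. j \<in> X - {i} \<Longrightarrow> finite (N j - {y})" using less.prems(2) by auto
      ultimately obtain \<sigma>' where \<sigma>': "inj_on \<sigma>' (X - {i})" "\<And>j. j \<in> X - {i} \<Longrightarrow> \<sigma>' j \<in> N j - {y}"
        using less.hyps[of "X - {i}" "\<lambda>j. N j - {y}"] less.prems(1) by blast
      have "inj_on (\<sigma>'(i := y)) X"
      proof (rule inj_onI)
        fix a b assume "a \<in> X" "b \<in> X" "(\<sigma>'(i := y)) a = (\<sigma>'(i := y)) b"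
        then show "a = b"
          using \<sigma>'(2)[of a] \<sigma>'(2)[of b] inj_onD[OF \<sigma>'(1), of a b] by (auto split: if_splits)
      qed
      moreover have "\<forall>j\<in>X. (\<sigma>'(i := y)) j \<in> N j" using \<sigma>'(2) y by auto
      ultimately show ?thesis by blast
    qed
  qed auto
qed

section \<open>Counting argument for concentrators\<close>

lemma binomial_le_pow3:
  assumes "0 < k"
  shows "real (n choose k) \<le> (3 * n / k) ^ k"
proof -
  \<comment> \<open>A single term of the exponential series gives
    \<open>k ^ k / fact k \<le> exp k\<close>.\<close>
  have "(\<Sum>j\<in>{k}. real k ^ j /\<^sub>R fact j) \<le> (\<Sum>j. real k ^ j /\<^sub>R fact j)"
    by (intro sum_le_suminf summable_exp_generic) auto
  then have "real k ^ k / fact k \<le> exp (real k)" by (simp add: exp_def divide_inverse mult.commute)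
  also have "exp (real k) = exp 1 ^ k" by (simp flip: exp_of_nat_mult)
  also have "\<dots> \<le> 3 ^ k" by (intro power_mono exp_le) auto
  finally have k: "real k ^ k \<le> 3 ^ k * fact k" by (simp add: divide_le_eq)
  have "real ((n choose k) * fact k) \<le> real (n ^ k)" using binomial_fact_pow[of n k] of_nat_mono by blast
  then have n: "real (n choose k) * fact k \<le> real n ^ k" by simp
  have "real (n choose k) * real k ^ k \<le> real (n choose k) * (3 ^ k * fact k)"
    using k by (intro mult_left_mono) auto
  also have "\<dots> = 3 ^ k * (real (n choose k) * fact k)" by simp
  also have "\<dots> \<le> 3 ^ k * real n ^ k" using n by (intro mult_left_mono) auto
  finally have "real (n choose k) * real k ^ k \<le> 3 ^ k * real n ^ k" .
  then show ?thesis using assms by (simp add: power_divide power_mult_distrib le_divide_eq)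
qed

text \<open>The probabilistic method as a count: among all ways to give each of \<open>4 * n\<close>
  inputs ten neighbours, with repetition, out of \<open>3 * n\<close> outputs, those violating
  Hall's condition for some set of at most \<open>2 * n\<close> inputs are too few to exhaust
  them.\<close>

theorem concentrator_exists:
  assumes n: "0 < n"
  obtains e :: "nat \<times> nat \<Rightarrow> nat"
  where "\<And>i d. \<lbrakk>i < 4 * n; d < 10\<rbrakk> \<Longrightarrow> e (i, d) < 3 * n"
    and "\<And>X. \<lbrakk>X \<subseteq> {..<4 * n}; card X \<le> 2 * n\<rbrakk> \<Longrightarrow> card X \<le> card (\<Union>i\<in>X. (\<lambda>d. e (i, d)) ` {..<10})"
proof -
  define D where "D = {..<4 * n} \<times> {..<10::nat}"
  define P where "P = D \<rightarrow>\<^sub>E {..<3 * n}"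
  define sub where "sub m k = {X. X \<subseteq> {..<m::nat} \<and> card X = k}" for m k :: nat
  \<comment> \<open>A violation by \<open>X\<close> puts all its neighbours into some
    \<open>Y\<close> of the same size as \<open>X\<close>; this weaker event is easy to
    count.\<close>
  define bad where "bad X Y = (\<Pi>\<^sub>E p\<in>D. if fst p \<in> X then Y else {..<3 * n})" for X Y :: "nat set"
  have finsub: "finite (sub m k)" "card (sub m k) = m choose k" for m k
    unfolding sub_def using n_subsets[of "{..<m}" k] by (auto intro: finite_subset[of _ "Pow {..<m}"])
  have card_bad: "card (bad X Y) = k ^ (10 * k) * (3 * n) ^ (10 * (4 * n - k))"
    if "X \<in> sub (4 * n) k" "Y \<in> sub (3 * n) k" for X Y k
  proof -
    have X: "X \<subseteq> {..<4 * n}" "card X = k" "finite X" using that finite_subset by (auto simp: sub_def)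
    have "card (bad X Y) = (\<Prod>p\<in>D. if fst p \<in> X then k else 3 * n)"
      unfolding bad_def D_def using that by (subst card_PiE) (auto simp: sub_def intro!: prod.cong)
    also have "\<dots> = (\<Prod>i<4 * n. \<Prod>d<10::nat. if i \<in> X then k else 3 * n)"
      unfolding D_def by (subst prod.cartesian_product) (simp add: case_prod_beta)
    also have "\<dots> = (\<Prod>i<4 * n. if i \<in> X then k ^ 10 else (3 * n) ^ 10)"
      by (intro prod.cong) auto
    also have "\<dots> = (k ^ 10) ^ card X * ((3 * n) ^ 10) ^ card ({..<4 * n} - X)"
      using X by (subst prod.If_cases) (auto simp: Int_absorb1 Diff_eq)
    finally show ?thesis using X by (simp add: card_Diff_subset power_mult)
  qed
  have "\<exists>e\<in>P. \<forall>k\<in>{1..2 * n}. \<forall>X\<in>sub (4 * n) k. \<forall>Y\<in>sub (3 * n) k. e \<notin> bad X Y"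
  proof (rule ccontr)
    assume "\<not> ?thesis"
    then have "P \<subseteq> (\<Union>k\<in>{1..2 * n}. \<Union>X\<in>sub (4 * n) k. \<Union>Y\<in>sub (3 * n) k. bad X Y)" (is "_ \<subseteq> ?B")
      by blast
    moreover have "finite ?B"
    proof (intro finite_UN_I finsub)
      fix k X Y assume "Y \<in> sub (3 * n) k"
      then have "finite Y" using finite_subset by (auto simp: sub_def)
      then show "finite (bad X Y)" unfolding bad_def D_def by (intro finite_PiE) auto
    qed simp
    ultimately have "card P \<le> card ?B" by (rule card_mono[rotated])
    also have "\<dots> \<le> (\<Sum>k\<in>{1..2 * n}. card (\<Union>X\<in>sub (4 * n) k. \<Union>Y\<in>sub (3 * n) k. bad X Y))"
      by (rule card_UN_le) simp
    also have "\<dots> \<le> (\<Sum>k\<in>{1..2 * n}. \<Sum>X\<in>sub (4 * n) k. card (\<Union>Y\<in>sub (3 * n) k. bad X Y))"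
      by (intro sum_mono card_UN_le finsub)
    also have "\<dots> \<le> (\<Sum>k\<in>{1..2 * n}. \<Sum>X\<in>sub (4 * n) k. \<Sum>Y\<in>sub (3 * n) k. card (bad X Y))"
      by (intro sum_mono card_UN_le finsub)
    also have "\<dots> = (\<Sum>k\<in>{1..2 * n}. (4 * n choose k) * ((3 * n choose k) * (k ^ (10 * k) * (3 * n) ^ (10 * (4 * n - k)))))"
      by (intro sum.cong refl) (simp add: card_bad finsub)
    finally have "real (card P) \<le> real (\<Sum>k\<in>{1..2 * n}. (4 * n choose k) * ((3 * n choose k) * (k ^ (10 * k) * (3 * n) ^ (10 * (4 * n - k)))))"
      by (rule of_nat_mono)
    also have "\<dots> \<le> (\<Sum>k\<in>{1..2 * n}. (1 / 2) ^ k * real (3 * n) ^ (40 * n))"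
      unfolding of_nat_sum
    proof (intro sum_mono)
      fix k assume "k \<in> {1..2 * n}"
      then have k: "0 < k" "k \<le> 2 * n" by auto
      \<comment> \<open>Relative to the total count, sets of size \<open>k\<close> contribute at
        most \<open>(12 * u ^ 8) ^ k\<close>: the binomials give \<open>12 / u\<^sup>2\<close>, the
        ten edges give \<open>u ^ 10\<close>. As \<open>u \<le> 2 / 3\<close>, the base is at most
        \<open>1 / 2\<close>, and the geometric sum stays below one.\<close>
      define u where "u = real k / (3 * n)"
      have u: "0 < u" "u \<le> 2 / 3" using k n by (auto simp: u_def field_simps)
      have "real (4 * n choose k) * real (3 * n choose k) \<le> (3 * (4 * n) / k) ^ k * (3 * (3 * n) / k) ^ k"
        using binomial_le_pow3[OF k(1), of "4 * n"] binomial_le_pow3[OF k(1), of "3 * n"]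
        by (intro mult_mono) auto
      also have "\<dots> = (12 / u\<^sup>2) ^ k"
      proof -
        have "3 * (4 * n) / k * (3 * (3 * n) / k) = 12 / u\<^sup>2"
          using k n by (simp add: u_def field_simps power2_eq_square)
        then show ?thesis by (simp only: power_mult_distrib[symmetric])
      qed
      finally have C: "real (4 * n choose k) * real (3 * n choose k) \<le> (12 / u\<^sup>2) ^ k" .
      have "real k ^ (10 * k) = u ^ (10 * k) * real (3 * n) ^ (10 * k)"
      proof -
        have "real k = u * real (3 * n)" using n by (simp add: u_def)
        then show ?thesis by (simp only: power_mult_distrib[symmetric])
      qed
      moreover have "real (3 * n) ^ (10 * k) * real (3 * n) ^ (10 * (4 * n - k)) = real (3 * n) ^ (40 * n)"
        unfolding power_add[symmetric] using k by (intro arg_cong[of _ _ "power _"]) auto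
      ultimately have "real k ^ (10 * k) * real (3 * n) ^ (10 * (4 * n - k)) = u ^ (10 * k) * real (3 * n) ^ (40 * n)"
        by (simp add: mult.assoc)
      then have "real ((4 * n choose k) * ((3 * n choose k) * (k ^ (10 * k) * (3 * n) ^ (10 * (4 * n - k)))))
          = (real (4 * n choose k) * real (3 * n choose k)) * (u ^ (10 * k) * real (3 * n) ^ (40 * n))"
        by simp
      also have "\<dots> \<le> (12 / u\<^sup>2) ^ k * (u ^ (10 * k) * real (3 * n) ^ (40 * n))"
        using C u by (intro mult_right_mono) auto
      also have "\<dots> = (12 * u ^ 8) ^ k * real (3 * n) ^ (40 * n)"
      proof -
        have "12 / u\<^sup>2 * u ^ 10 = 12 * u ^ 8" using u by (simp add: field_simps power_numeral_reduce)
        then have "(12 / u\<^sup>2) ^ k * u ^ (10 * k) = (12 * u ^ 8) ^ k"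
          by (simp only: power_mult power_mult_distrib[symmetric])
        then show ?thesis by (simp only: mult.assoc[symmetric])
      qed
      also have "\<dots> \<le> (1 / 2) ^ k * real (3 * n) ^ (40 * n)"
      proof (intro mult_right_mono power_mono)
        have "u ^ 8 \<le> (2 / 3) ^ 8" using u by (intro power_mono) auto
        then show "12 * u ^ 8 \<le> 1 / 2" by (simp add: power_divide)
      qed (use u in auto)
      finally show "real ((4 * n choose k) * ((3 * n choose k) * (k ^ (10 * k) * (3 * n) ^ (10 * (4 * n - k)))))
          \<le> (1 / 2) ^ k * real (3 * n) ^ (40 * n)" .
    qed
    also have "\<dots> = (\<Sum>k\<in>{1..2 * n}. (1 / 2) ^ k) * real (3 * n) ^ (40 * n)" by (simp add: sum_distrib_right)
    also have "\<dots> < 1 * real (3 * n) ^ (40 * n)"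
    proof (rule mult_strict_right_mono)
      have "(\<Sum>k\<in>{1..m}. (1 / 2 :: real) ^ k) = 1 - (1 / 2) ^ m" for m
        by (induction m) (auto simp: field_simps)
      then show "(\<Sum>k\<in>{1..2 * n}. (1 / 2 :: real) ^ k) < 1" by simp
    qed (use n in simp)
    also have "\<dots> = real (card P)"
      unfolding P_def D_def by (simp add: card_PiE card_cartesian_product)
    finally show False by simp
  qed
  then obtain e where e: "e \<in> P"
    and nb: "\<And>k X Y. \<lbrakk>k \<in> {1..2 * n}; X \<in> sub (4 * n) k; Y \<in> sub (3 * n) k\<rbrakk> \<Longrightarrow> e \<notin> bad X Y" by blast
  show thesis
  proof (rule that[of e])
    show ran: "e (i, d) < 3 * n" if "i < 4 * n" "d < 10" for i d
      using PiE_mem[OF e[unfolded P_def], of "(i, d)"] that by (simp add: D_def)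
    fix X assume X: "X \<subseteq> {..<4 * n}" "card X \<le> 2 * n"
    let ?N = "\<Union>i\<in>X. (\<lambda>d. e (i, d)) ` {..<10}"
    show "card X \<le> card ?N"
    proof (rule ccontr)
      assume lt: "\<not> card X \<le> card ?N"
      have N: "?N \<subseteq> {..<3 * n}" using X ran by auto
      obtain Y where Y: "?N \<subseteq> Y" "Y \<subseteq> {..<3 * n}" "card Y = card X"
        using exists_subset_between[of ?N "card X" "{..<3 * n}"] N lt X by auto
      have "e \<in> bad X Y"
        unfolding bad_def
      proof (rule PiE_I)
        fix p assume p: "p \<in> D"
        then have "e p < 3 * n" using ran by (cases p) (auto simp: D_def)
        moreover have "e p \<in> ?N" if "fst p \<in> X" using that p by (cases p) (force simp: D_def)
        ultimately show "e p \<in> (if fst p \<in> X then Y else {..<3 * n})" using Y(1) by auto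
      qed (use e in \<open>auto simp: P_def\<close>)
      then show False using nb[of "card X" X Y] X Y lt by (auto simp: sub_def)
    qed
  qed
qed

section \<open>The Kalton--Roberts theorem\<close>

definition balanced_bound :: "'p set set \<Rightarrow> ('p set \<Rightarrow> real) \<Rightarrow> real \<Rightarrow> bool" where
  "balanced_bound \<F> f W \<longleftrightarrow>
     (\<forall>m A B. (\<forall>i<m. A i \<in> \<F> \<and> B i \<in> \<F>) \<longrightarrow>
        (\<forall>x. (\<Sum>i<m. indicator (A i) x) = (\<Sum>i<m. indicator (B i) x :: int)) \<longrightarrow>
        (\<Sum>i<m. f (A i) - f (B i)) \<le> real (m::nat) * W)"

lemma balanced_boundD:
  fixes A B :: "nat \<Rightarrow> 'p set"
  assumes "balanced_bound \<F> f W" "\<And>i. i < m \<Longrightarrow> A i \<in> \<F>" "\<And>i. i < m \<Longrightarrow> B i \<in> \<F>"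
    and "\<And>x. (\<Sum>i<m. indicator (A i) x) = (\<Sum>i<m. indicator (B i) x :: int)"
  shows "(\<Sum>i<m. f (A i) - f (B i)) \<le> real m * W"
  using assms unfolding balanced_bound_def by blast

lemma sum_list_fun_apply: "sum_list fs x = (\<Sum>f\<leftarrow>fs. f x)"
  by (induction fs) auto

text \<open>Integer-valued functions form the group to which \<open>consistent_imp_additive\<close>
  is applied. The constraint attached to \<open>(C, D)\<close> is the desired inequality, and a list
  of constraints sums to zero exactly when its first and its second sets form balanced lists, so
  consistency is the bound \<open>W\<close>.\<close>

lemma balanced_bound_imp_additive:
  fixes f :: "'p set \<Rightarrow> real"
  assumes W: "balanced_bound \<F> f W"
  obtains \<phi> :: "('p \<Rightarrow> int) \<Rightarrow> real" where "\<And>x y. \<phi> (x + y) = \<phi> x + \<phi> y"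
    and "\<And>C D. \<lbrakk>C \<in> \<F>; D \<in> \<F>\<rbrakk> \<Longrightarrow> (f C - \<phi> (indicator C)) - (f D - \<phi> (indicator D)) \<le> W"
proof -
  define h :: "'p set \<times> 'p set \<Rightarrow> ('p \<Rightarrow> int) \<times> real"
    where "h = (\<lambda>(C, D). (indicator D - indicator C, W + f D - f C))"
  have "consistent (h ` (\<F> \<times> \<F>))"
    unfolding consistent_def
  proof (intro conjI allI impI)
    show "\<forall>(v, c)\<in>h ` (\<F> \<times> \<F>). \<exists>d. (- v, d) \<in> h ` (\<F> \<times> \<F>)"
    proof clarify
      fix v c C D assume CD: "(v, c) = h (C, D)" "C \<in> \<F>" "D \<in> \<F>"
      then have "(- v, W + f C - f D) = h (D, C)" by (simp add: h_def)
      then show "\<exists>d. (- v, d) \<in> h ` (\<F> \<times> \<F>)" using CD(2,3) by blast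
    qed
    fix xs assume xs: "set xs \<subseteq> h ` (\<F> \<times> \<F>) \<and> sum_list (map fst xs) = 0"
    then have "xs \<in> lists (h ` (\<F> \<times> \<F>))" by blast
    then obtain ps where ps: "xs = map h ps" "set ps \<subseteq> \<F> \<times> \<F>" unfolding lists_image by auto
    define A where "A i = fst (ps ! i)" for i
    define B where "B i = snd (ps ! i)" for i
    have AB: "A i \<in> \<F>" "B i \<in> \<F>" if "i < length ps" for i
      using ps(2) nth_mem[OF that] by (auto simp: A_def B_def mem_Times_iff)
    have sum: "sum_list (map k ps) = (\<Sum>i<length ps. k (ps ! i))" for k :: "_ \<Rightarrow> 'z::comm_monoid_add"
      by (simp add: sum_list_sum_nth atLeast0LessThan)
    have "(\<Sum>i<length ps. indicator (B i) x - indicator (A i) x :: int) = 0" for x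
    proof -
      have "0 = sum_list (map fst xs) x" using xs by simp
      also have "\<dots> = (\<Sum>p\<leftarrow>ps. fst (h p) x)" by (simp add: ps(1) sum_list_fun_apply comp_def)
      also have "\<dots> = (\<Sum>i<length ps. indicator (B i) x - indicator (A i) x)"
        unfolding sum by (simp add: h_def A_def B_def case_prod_beta)
      finally show ?thesis by simp
    qed
    then have "(\<Sum>i<length ps. f (A i) - f (B i)) \<le> real (length ps) * W"
      by (intro balanced_boundD[OF W] AB) (auto simp: sum_subtractf)
    moreover have "sum_list (map snd xs) = (\<Sum>i<length ps. W + f (B i) - f (A i))"
      unfolding ps(1) map_map sum by (simp add: h_def A_def B_def case_prod_beta)
    ultimately show "0 \<le> sum_list (map snd xs)" by (simp add: sum.distrib sum_subtractf)
  qed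
  then obtain \<phi> where \<phi>: "\<And>x y. \<phi> (x + y) = \<phi> x + \<phi> y"
    "\<And>v c. (v, c) \<in> h ` (\<F> \<times> \<F>) \<Longrightarrow> \<phi> v \<le> c"
    by (rule consistent_imp_additive) blast
  interpret additive \<phi> by unfold_locales (rule \<phi>)
  show thesis
  proof (rule that[OF \<phi>(1)])
    fix C D assume "C \<in> \<F>" "D \<in> \<F>"
    then have "\<phi> (indicator D - indicator C) \<le> W + f D - f C"
      by (intro \<phi>(2)) (auto simp: h_def intro: rev_image_eqI[of "(C, D)"])
    then show "(f C - \<phi> (indicator C)) - (f D - \<phi> (indicator D)) \<le> W" by (simp add: diff)
  qed
qed

section \<open>Recombining sparse families of sets along a concentrator\<close>

lemma one_additive_UN:
  fixes g :: "'p set \<Rightarrow> real"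
  assumes g: "one_additive (Pow \<Omega>) g" and "finite I"
    and "\<And>i. i \<in> I \<Longrightarrow> S i \<subseteq> \<Omega>" "disjoint_family_on S I"
  shows "\<bar>g (\<Union>i\<in>I. S i) - (\<Sum>i\<in>I. g (S i))\<bar> \<le> card I + 1"
  using assms(2-)
proof (induction I rule: finite_induct)
  \<comment> \<open>The extra one in the bound arises here: \<open>g {}\<close> need not vanish,
    only \<open>\<bar>g {}\<bar> \<le> 1\<close> is known.\<close>
  case empty
  then show ?case using one_additiveD[OF g, of "{}" "{}"] by simp
next
  case (insert i I)
  have "S i \<inter> (\<Union>j\<in>I. S j) = {}"
    using insert.prems(2) insert.hyps unfolding disjoint_family_on_def by fastforce
  then have "\<bar>g (S i \<union> (\<Union>j\<in>I. S j)) - g (S i) - g (\<Union>j\<in>I. S j)\<bar> \<le> 1"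
    using one_additiveD[OF g, of "S i" "\<Union>j\<in>I. S j"] insert.prems(1) by auto
  moreover have "\<bar>g (\<Union>j\<in>I. S j) - (\<Sum>j\<in>I. g (S j))\<bar> \<le> card I + 1"
    using insert.prems by (intro insert.IH) (auto simp: disjoint_family_on_def)
  ultimately show ?case using insert.hyps by auto
qed

text \<open>Hall's theorem, applied at every point \<open>x\<close>, sends the at most
  \<open>2 * n\<close> sets containing \<open>x\<close> to distinct outputs. Cutting each
  \<open>C i\<close> by the output chosen yields at most ten pieces, and the pieces arriving at one
  output are disjoint; their unions are the \<open>3 * n\<close> new sets.\<close>

lemma concentrate:
  fixes g :: "'p set \<Rightarrow> real"
  assumes g: "one_additive (Pow \<Omega>) g" and n: "0 < n"
    and C: "\<And>i. i < 4 * n \<Longrightarrow> C i \<subseteq> \<Omega>" and few: "\<And>x. card {i. i < 4 * n \<and> x \<in> C i} \<le> 2 * n"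
  obtains E where "\<And>j. j < 3 * n \<Longrightarrow> E j \<subseteq> \<Omega>"
    "\<bar>(\<Sum>i<4 * n. g (C i)) - (\<Sum>j<3 * n. g (E j))\<bar> \<le> 87 * real n"
proof -
  obtain e :: "nat \<times> nat \<Rightarrow> nat" where e: "\<And>i d. \<lbrakk>i < 4 * n; d < 10\<rbrakk> \<Longrightarrow> e (i, d) < 3 * n"
    and exp: "\<And>X. \<lbrakk>X \<subseteq> {..<4 * n}; card X \<le> 2 * n\<rbrakk> \<Longrightarrow> card X \<le> card (\<Union>i\<in>X. (\<lambda>d. e (i, d)) ` {..<10})"
    by (rule concentrator_exists[OF n]) blast
  define N where "N i = (\<lambda>d. e (i, d)) ` {..<10}" for i
  have N: "N i \<subseteq> {..<3 * n}" if "i < 4 * n" for i using e that by (auto simp: N_def)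
  have finN: "finite (N i)" and cardN: "card (N i) \<le> 10" for i
    using card_image_le[of "{..<10::nat}" "\<lambda>d. e (i, d)"] by (auto simp: N_def)
  define X where "X x = {i. i < 4 * n \<and> x \<in> C i}" for x
  have "\<exists>\<sigma>. inj_on \<sigma> (X x) \<and> (\<forall>i\<in>X x. \<sigma> i \<in> N i)" for x
  proof (rule Hall)
    show fin: "finite (X x)" by (simp add: X_def)
    fix Y assume Y: "Y \<subseteq> X x"
    then have "card Y \<le> 2 * n" using card_mono[OF fin Y] few[of x] by (simp add: X_def)
    then show "card Y \<le> card (\<Union>i\<in>Y. N i)"
      unfolding N_def using Y by (intro exp) (auto simp: X_def)
  qed (rule finN)
  then obtain \<sigma> where \<sigma>: "\<And>x. inj_on (\<sigma> x) (X x)" "\<And>x i. i \<in> X x \<Longrightarrow> \<sigma> x i \<in> N i" by metis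
  define P where "P i j = {x \<in> C i. \<sigma> x i = j}" for i j
  define M where "M j = {i. i < 4 * n \<and> j \<in> N i}" for j
  define E where "E j = (\<Union>i\<in>M j. P i j)" for j
  have P: "P i j \<subseteq> \<Omega>" if "i < 4 * n" for i j using C[OF that] by (auto simp: P_def)
  have inp: "\<bar>g (C i) - (\<Sum>j\<in>N i. g (P i j))\<bar> \<le> 11" if i: "i < 4 * n" for i
  proof -
    have "C i = (\<Union>j\<in>N i. P i j)" using \<sigma>(2) i by (auto simp: P_def X_def)
    moreover have "\<bar>g (\<Union>j\<in>N i. P i j) - (\<Sum>j\<in>N i. g (P i j))\<bar> \<le> card (N i) + 1"
      using P[OF i] finN by (intro one_additive_UN[OF g]) (auto simp: disjoint_family_on_def P_def)
    ultimately show ?thesis using cardN[of i] by simp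
  qed
  have out: "\<bar>g (E j) - (\<Sum>i\<in>M j. g (P i j))\<bar> \<le> card (M j) + 1" for j
    unfolding E_def
  proof (rule one_additive_UN[OF g])
    show "disjoint_family_on (\<lambda>i. P i j) (M j)"
      unfolding disjoint_family_on_def
    proof (intro ballI impI equals0I)
      fix i i' x assume "i \<in> M j" "i' \<in> M j" "i \<noteq> i'" "x \<in> P i j \<inter> P i' j"
      then show False using inj_onD[OF \<sigma>(1)[of x], of i i'] by (auto simp: M_def P_def X_def)
    qed
  qed (use P in \<open>auto simp: M_def\<close>)
  have swap: "(\<Sum>i<4 * n. \<Sum>j\<in>N i. k i j) = (\<Sum>j<3 * n. \<Sum>i\<in>M j. k i j)" for k :: "nat \<Rightarrow> nat \<Rightarrow> real"
  proof -
    have "(\<Sum>i<4 * n. \<Sum>j\<in>N i. k i j) = (\<Sum>i<4 * n. \<Sum>j | j \<in> {..<3 * n} \<and> j \<in> N i. k i j)"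
      using N by (intro sum.cong refl) (auto intro!: sum.cong)
    also have "\<dots> = (\<Sum>j<3 * n. \<Sum>i | i \<in> {..<4 * n} \<and> j \<in> N i. k i j)"
      by (rule sum.swap_restrict) auto
    finally show ?thesis by (simp add: M_def)
  qed
  show thesis
  proof
    show "E j \<subseteq> \<Omega>" for j using P by (auto simp: E_def M_def)
    \<comment> \<open>Cutting costs \<open>11\<close> for each of the \<open>4 * n\<close> sets;
      gluing costs one per piece, at most \<open>40 * n\<close>, and one for each of the
      \<open>3 * n\<close> outputs: in total \<open>87 * n\<close>.\<close>
    have "\<bar>(\<Sum>i<4 * n. g (C i)) - (\<Sum>i<4 * n. \<Sum>j\<in>N i. g (P i j))\<bar> \<le> (\<Sum>i<4 * n. 11)"
      unfolding sum_subtractf[symmetric] by (intro order_trans[OF sum_abs] sum_mono inp) simp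
    moreover have "\<bar>(\<Sum>j<3 * n. g (E j)) - (\<Sum>j<3 * n. \<Sum>i\<in>M j. g (P i j))\<bar> \<le> (\<Sum>j<3 * n. card (M j) + 1)"
      unfolding sum_subtractf[symmetric] of_nat_sum
      by (intro order_trans[OF sum_abs] sum_mono) (use out in simp)
    moreover have "real (\<Sum>j<3 * n. card (M j)) \<le> (\<Sum>i<4 * n. 10)"
    proof -
      have "real (\<Sum>j<3 * n. card (M j)) = (\<Sum>i<4 * n. real (card (N i)))"
        using swap[of "\<lambda>_ _. 1"] by simp
      also have "\<dots> \<le> (\<Sum>i<4 * n. 10)" using cardN by (intro sum_mono) (metis of_nat_le_iff of_nat_numeral)
      finally show ?thesis .
    qed
    ultimately show "\<bar>(\<Sum>i<4 * n. g (C i)) - (\<Sum>j<3 * n. g (E j))\<bar> \<le> 87 * real n"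
      using swap[of "\<lambda>i j. g (P i j)"] by (simp add: sum.distrib)
  qed
qed

text \<open>For listing each of \<open>m\<close> sets four times, since the concentrator takes a
  number of inputs divisible by four.\<close>

lemma sum_div_4: "(\<Sum>i<4 * m. h (i div 4)) = 4 * (\<Sum>i<m. h i :: 'a::comm_ring_1)" for m :: nat
proof (induction m)
  case (Suc m)
  have eq: "4 * Suc m = Suc (Suc (Suc (Suc (4 * m))))" by simp
  have "4 * m div 4 = m" "Suc (4 * m) div 4 = m" "Suc (Suc (4 * m)) div 4 = m" "Suc (Suc (Suc (4 * m))) div 4 = m"
    by presburger+
  then show ?case unfolding eq sum.lessThan_Suc using Suc by (simp only:) (simp add: algebra_simps)
qed simp

lemma card_Collect_indicator:
  fixes m :: nat
  shows "int (card {i. i < m \<and> x \<in> A i}) = (\<Sum>i<m. indicator (A i) x)"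
proof -
  have "{i. i < m \<and> x \<in> A i} = {..<m} \<inter> {i. x \<in> A i}" by auto
  then show ?thesis by (simp add: indicator_def of_bool_def sum.If_cases)
qed

text \<open>After subtraction of the additive map supplied by \<open>W\<close>, differences are at
  most \<open>W\<close> for every single pair of sets, not only on average. The lists are made
  sparse by mixing with complements, and concentrating their fourfold repetitions replaces
  \<open>4 * m\<close> differences by \<open>3 * m\<close>, whence the factor
  \<open>3 / 4\<close>.\<close>

lemma balanced_bound_step:
  fixes f :: "'p set \<Rightarrow> real"
  assumes f: "one_additive (Pow \<Omega>) f" and W: "balanced_bound (Pow \<Omega>) f W"
  shows "balanced_bound (Pow \<Omega>) f (3 / 4 * W + 50)"
  unfolding balanced_bound_def
proof (intro allI impI)
  fix m :: nat and A B :: "nat \<Rightarrow> 'p set"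
  assume AB: "\<forall>i<m. A i \<in> Pow \<Omega> \<and> B i \<in> Pow \<Omega>"
    and bal: "\<forall>x. (\<Sum>i<m. indicator (A i) x) = (\<Sum>i<m. indicator (B i) x :: int)"
  show "(\<Sum>i<m. f (A i) - f (B i)) \<le> real m * (3 / 4 * W + 50)"
  proof (cases "m = 0")
    case False
    then have m: "0 < m" by simp
    obtain \<phi> :: "('p \<Rightarrow> int) \<Rightarrow> real" where add: "\<And>x y. \<phi> (x + y) = \<phi> x + \<phi> y"
      and osc: "\<And>C D. \<lbrakk>C \<in> Pow \<Omega>; D \<in> Pow \<Omega>\<rbrakk> \<Longrightarrow> (f C - \<phi> (indicator C)) - (f D - \<phi> (indicator D)) \<le> W"
      by (rule balanced_bound_imp_additive[OF W]) blast
    interpret additive \<phi> by unfold_locales (rule add)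
    define g where "g C = f C - \<phi> (indicator C)" for C
    have g: "one_additive (Pow \<Omega>) g"
      unfolding one_additive_def
    proof (intro ballI impI)
      fix S T assume "S \<in> Pow \<Omega>" "T \<in> Pow \<Omega>" "S \<inter> T = {}"
      moreover from this have "indicator (S \<union> T) = (indicator S + indicator T :: 'p \<Rightarrow> int)"
        by (auto simp: fun_eq_iff indicator_def)
      ultimately show "norm (g (S \<union> T) - g S - g T) \<le> 1"
        using one_additiveD[OF f, of S T] by (simp add: g_def add)
    qed
    define k where "k x = (\<Sum>i<m. indicator (A i) x :: int)" for x
    \<comment> \<open>Pairing \<open>A i\<close> on the sparsely covered points with the complement of \<open>B i\<close> on the densely
      covered ones yields sets that cover every point at most half of the time.\<close>
    define \<Omega>1 where "\<Omega>1 = {x \<in> \<Omega>. 2 * k x \<le> m}"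
    define \<Omega>2 where "\<Omega>2 = \<Omega> - \<Omega>1"
    define mix where "mix S T = (S \<inter> \<Omega>1) \<union> (\<Omega>2 - T)" for S T
    have mix: "mix S T \<subseteq> \<Omega>" if "S \<subseteq> \<Omega>" for S T using that by (auto simp: mix_def \<Omega>2_def)
    \<comment> \<open>On \<open>\<Omega>1\<close> a mixed list covers \<open>x\<close> exactly
      \<open>k x\<close> times, on \<open>\<Omega>2\<close> exactly \<open>m - k x\<close> times, in
      both cases at most \<open>m / 2\<close>; repeating each set four times turns this into
      \<open>2 * m\<close>.\<close>
    have few: "card {i. i < 4 * m \<and> x \<in> mix (S (i div 4)) (T (i div 4))} \<le> 2 * m"
      if "(\<Sum>i<m. indicator (S i) x) = k x" "(\<Sum>i<m. indicator (T i) x) = k x" for S T x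
    proof -
      have "int (card {i. i < 4 * m \<and> x \<in> mix (S (i div 4)) (T (i div 4))})
          = 4 * (\<Sum>i<m. indicator (mix (S i) (T i)) x)"
        using sum_div_4[of "\<lambda>i. indicator (mix (S i) (T i)) x :: int" m]
        by (simp add: card_Collect_indicator)
      also have "(\<Sum>i<m. indicator (mix (S i) (T i)) x :: int)
          = (if x \<in> \<Omega>1 then (\<Sum>i<m. indicator (S i) x) else if x \<in> \<Omega>2 then (\<Sum>i<m. 1 - indicator (T i) x) else 0)"
        by (auto simp: mix_def \<Omega>2_def indicator_def simp del: sum_of_bool_eq intro!: sum.cong)
      also have "4 * \<dots> \<le> 2 * m"
        using that by (auto simp: sum_subtractf \<Omega>1_def \<Omega>2_def)
      finally show ?thesis by linarith
    qed
    define C where "C i = mix (A i) (B i)" for i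
    define D where "D i = mix (B i) (A i)" for i
    have kA: "(\<Sum>i<m. indicator (A i) x) = k x" for x by (simp add: k_def)
    have kB: "(\<Sum>i<m. indicator (B i) x) = k x" for x using bal by (simp add: k_def)
    have d4: "i div 4 < m" if "i < 4 * m" for i using that by linarith
    obtain E where E: "\<And>j. j < 3 * m \<Longrightarrow> E j \<subseteq> \<Omega>"
      "\<bar>(\<Sum>i<4 * m. g (C (i div 4))) - (\<Sum>j<3 * m. g (E j))\<bar> \<le> 87 * real m"
    proof (rule concentrate[OF g m, of "\<lambda>i. C (i div 4)"])
      show "C (i div 4) \<subseteq> \<Omega>" if "i < 4 * m" for i
        unfolding C_def using AB d4[OF that] by (intro mix) auto
      show "card {i. i < 4 * m \<and> x \<in> C (i div 4)} \<le> 2 * m" for x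
        unfolding C_def by (rule few) (rule kA kB)+
    qed blast
    obtain E' where E': "\<And>j. j < 3 * m \<Longrightarrow> E' j \<subseteq> \<Omega>"
      "\<bar>(\<Sum>i<4 * m. g (D (i div 4))) - (\<Sum>j<3 * m. g (E' j))\<bar> \<le> 87 * real m"
    proof (rule concentrate[OF g m, of "\<lambda>i. D (i div 4)"])
      show "D (i div 4) \<subseteq> \<Omega>" if "i < 4 * m" for i
        unfolding D_def using AB d4[OF that] by (intro mix) auto
      show "card {i. i < 4 * m \<and> x \<in> D (i div 4)} \<le> 2 * m" for x
        unfolding D_def by (rule few) (rule kA kB)+
    qed blast
    \<comment> \<open>Six uses of one-additivity: splitting \<open>A i\<close> and
      \<open>B i\<close> along \<open>\<Omega>1\<close>, splitting \<open>\<Omega>2\<close> by each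
      of them, and assembling the two mixed sets. The terms \<open>g \<Omega>2\<close>
      cancel.\<close>
    have pair: "g (A i) - g (B i) \<le> g (C i) - g (D i) + 6" if "i < m" for i
    proof -
      have sub: "A i \<subseteq> \<Omega>" "B i \<subseteq> \<Omega>" using AB that by auto
      have split: "\<bar>g (S \<union> T) - g S - g T\<bar> \<le> 1" if "S \<subseteq> \<Omega>" "T \<subseteq> \<Omega>" "S \<inter> T = {}" for S T
        using one_additiveD[OF g, of S T] that by auto
      have whole: "\<bar>g S - g (S \<inter> \<Omega>1) - g (S \<inter> \<Omega>2)\<bar> \<le> 1"
        and \<Omega>2: "\<bar>g \<Omega>2 - g (S \<inter> \<Omega>2) - g (\<Omega>2 - S)\<bar> \<le> 1" if "S \<subseteq> \<Omega>" for S
      proof -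
        have "S \<inter> \<Omega>1 \<union> S \<inter> \<Omega>2 = S" "S \<inter> \<Omega>2 \<union> (\<Omega>2 - S) = \<Omega>2"
          using that by (auto simp: \<Omega>1_def \<Omega>2_def)
        then show "\<bar>g S - g (S \<inter> \<Omega>1) - g (S \<inter> \<Omega>2)\<bar> \<le> 1"
          "\<bar>g \<Omega>2 - g (S \<inter> \<Omega>2) - g (\<Omega>2 - S)\<bar> \<le> 1"
          using split[of "S \<inter> \<Omega>1" "S \<inter> \<Omega>2"] split[of "S \<inter> \<Omega>2" "\<Omega>2 - S"] that
          by (auto simp: \<Omega>2_def)
      qed
      have mixed: "\<bar>g (mix S T) - g (S \<inter> \<Omega>1) - g (\<Omega>2 - T)\<bar> \<le> 1" if "S \<subseteq> \<Omega>" for S T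
        unfolding mix_def using that by (intro split) (auto simp: \<Omega>2_def)
      show ?thesis
        unfolding C_def D_def
        using whole[OF sub(1)] whole[OF sub(2)] \<Omega>2[OF sub(1)] \<Omega>2[OF sub(2)]
          mixed[OF sub(1), of "B i"] mixed[OF sub(2), of "A i"] by linarith
    qed
    \<comment> \<open>By balance, the additive part contributes the same to both lists, so
      \<open>f\<close> may be replaced by \<open>g\<close>.\<close>
    have "(\<Sum>i<m. \<phi> (indicator (A i))) = \<phi> (\<Sum>i<m. indicator (A i))" for A :: "nat \<Rightarrow> 'p set"
      by (simp add: sum)
    moreover have "(\<Sum>i<m. indicator (A i) :: 'p \<Rightarrow> int) = (\<Sum>i<m. indicator (B i))"
    proof -
      have "(\<Sum>i<j. h i) x = (\<Sum>i<j. h i x)" for h :: "nat \<Rightarrow> 'p \<Rightarrow> int" and j x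
        by (induction j) auto
      then show ?thesis using bal by (simp add: fun_eq_iff)
    qed
    ultimately have "(\<Sum>i<m. f (A i) - f (B i)) = (\<Sum>i<m. g (A i) - g (B i))"
      by (simp add: g_def sum_subtractf)
    also have "\<dots> \<le> (\<Sum>i<m. g (C i) - g (D i) + 6)" by (intro sum_mono pair) simp
    also have "\<dots> = ((\<Sum>i<4 * m. g (C (i div 4))) - (\<Sum>i<4 * m. g (D (i div 4)))) / 4 + 6 * m"
      using sum_div_4[of "\<lambda>i. g (C i)" m] sum_div_4[of "\<lambda>i. g (D i)" m]
      by (simp add: sum.distrib sum_subtractf)
    \<comment> \<open>The error per set is \<open>174 / 4 + 6 = 49.5\<close>, from two
      concentrations and the pairing; it is rounded up to \<open>50\<close>.\<close>
    also have "\<dots> \<le> ((\<Sum>j<3 * m. g (E j) - g (E' j)) + 174 * m) / 4 + 6 * m"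
      using E(2) E'(2) by (simp add: sum_subtractf)
    also have "(\<Sum>j<3 * m. g (E j) - g (E' j)) \<le> (\<Sum>j<3 * m. W)"
      using E(1) E'(1) osc by (intro sum_mono) (auto simp: g_def)
    finally show ?thesis by (simp add: algebra_simps add_divide_distrib)
  qed simp
qed

section \<open>The absolute constant, first for finite power sets and then for arbitrary
  algebras\<close>

lemma balanced_bound_nonneg:
  assumes "balanced_bound \<F> f W" "{} \<in> \<F>" shows "0 \<le> W"
  using balanced_boundD[OF assms(1), of 1 "\<lambda>_. {}" "\<lambda>_. {}"] assms(2) by simp

text \<open>On a finite set \<open>f\<close> is bounded, so some bound exists, and the infimum of
  all bounds is itself a bound. For it, \<open>balanced_bound_step\<close> gives
  \<open>W \<le> 3 / 4 * W + 50\<close>, that is, \<open>W \<le> 200\<close>.\<close>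

lemma balanced_bound_finite:
  fixes f :: "'p set \<Rightarrow> real"
  assumes f: "one_additive (Pow \<Omega>) f" and "finite \<Omega>"
  shows "balanced_bound (Pow \<Omega>) f 200"
proof -
  define \<W> where "\<W> = {W. balanced_bound (Pow \<Omega>) f W}"
  define b where "b = (\<Sum>A\<in>Pow \<Omega>. \<bar>f A\<bar>)"
  have b: "\<bar>f A\<bar> \<le> b" if "A \<subseteq> \<Omega>" for A
    unfolding b_def using that assms(2) by (intro member_le_sum) auto
  have "balanced_bound (Pow \<Omega>) f (2 * b)"
    unfolding balanced_bound_def
  proof (intro allI impI)
    fix m :: nat and A B :: "nat \<Rightarrow> 'p set" assume "\<forall>i<m. A i \<in> Pow \<Omega> \<and> B i \<in> Pow \<Omega>"
    then have "f (A i) - f (B i) \<le> 2 * b" if "i < m" for i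
      using b[of "A i"] b[of "B i"] that by (auto simp: abs_le_iff)
    then show "(\<Sum>i<m. f (A i) - f (B i)) \<le> real m * (2 * b)"
      using sum_bounded_above[of "{..<m}" "\<lambda>i. f (A i) - f (B i)" "2 * b"] by simp
  qed
  then have ne: "\<W> \<noteq> {}" by (auto simp: \<W>_def)
  have bdd: "bdd_below \<W>" using balanced_bound_nonneg by (intro bdd_belowI[of _ 0]) (auto simp: \<W>_def)
  have inf: "balanced_bound (Pow \<Omega>) f (Inf \<W>)"
    unfolding balanced_bound_def
  proof (intro allI impI)
    fix m :: nat and A B :: "nat \<Rightarrow> 'p set"
    assume *: "\<forall>i<m. A i \<in> Pow \<Omega> \<and> B i \<in> Pow \<Omega>"
      "\<forall>x. (\<Sum>i<m. indicator (A i) x) = (\<Sum>i<m. indicator (B i) x :: int)"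
    show "(\<Sum>i<m. f (A i) - f (B i)) \<le> real m * Inf \<W>"
    proof (cases "m = 0")
      case False
      have "(\<Sum>i<m. f (A i) - f (B i)) / m \<le> W" if "W \<in> \<W>" for W
        using balanced_boundD[of "Pow \<Omega>" f W m A B] that * False
        by (simp add: \<W>_def divide_le_eq mult.commute)
      then have "(\<Sum>i<m. f (A i) - f (B i)) / m \<le> Inf \<W>" by (intro cInf_greatest ne)
      then show ?thesis using False by (simp add: divide_le_eq mult.commute)
    qed simp
  qed
  then have "Inf \<W> \<le> 3 / 4 * Inf \<W> + 50"
    by (intro cInf_lower bdd) (use balanced_bound_step[OF f inf] in \<open>simp only: \<W>_def mem_Collect_eq\<close>)
  then have "Inf \<W> \<le> 200" by simp
  then have "real m * Inf \<W> \<le> real m * 200" for m by (intro mult_left_mono) auto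
  then show ?thesis using inf unfolding balanced_bound_def by (meson order_trans)
qed

text \<open>A balanced inequality concerns finitely many sets only. \<open>h\<close> records the
  membership pattern of a point in all of them; it has finitely many values, and pulling back along
  it reduces to the power set of a finite set.\<close>

lemma balanced_bound_algebra:
  fixes f :: "'p set \<Rightarrow> real"
  assumes alg: "algebra \<Omega> \<F>" and f: "one_additive \<F> f"
  shows "balanced_bound \<F> f 200"
  unfolding balanced_bound_def
proof (intro allI impI)
  interpret algebra \<Omega> \<F> by (rule alg)
  fix m :: nat and A B :: "nat \<Rightarrow> 'p set"
  assume AB: "\<forall>i<m. A i \<in> \<F> \<and> B i \<in> \<F>"
    and bal: "\<forall>x. (\<Sum>i<m. indicator (A i) x) = (\<Sum>i<m. indicator (B i) x :: int)"
  define h where "h x = ({i. i < m \<and> x \<in> A i}, {i. i < m \<and> x \<in> B i})" for x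
  have "h ` \<Omega> \<subseteq> Pow {..<m} \<times> Pow {..<m}" by (auto simp: h_def)
  then have fin: "finite (h ` \<Omega>)" by (rule finite_subset) auto
  have mem: "{x \<in> \<Omega>. x \<in> A i} \<in> \<F>" "{x \<in> \<Omega>. x \<in> B i} \<in> \<F>" if "i < m" for i
    using AB that Int_absorb1[OF sets_into_space] by (auto simp: Int_def)
  have fibre: "{x \<in> \<Omega>. h x = t} \<in> \<F>" for t
  proof (cases "fst t \<subseteq> {..<m} \<and> snd t \<subseteq> {..<m}")
    case True
    have "{x \<in> \<Omega>. (x \<in> A i \<longleftrightarrow> i \<in> fst t) \<and> (x \<in> B i \<longleftrightarrow> i \<in> snd t)} \<in> \<F>" if "i < m" for i
      using mem[OF that] by (intro sets_Collect_conj; cases "i \<in> fst t"; cases "i \<in> snd t") (auto intro: sets_Collect_neg)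
    then have "{x \<in> \<Omega>. \<forall>i\<in>{..<m}. (x \<in> A i \<longleftrightarrow> i \<in> fst t) \<and> (x \<in> B i \<longleftrightarrow> i \<in> snd t)} \<in> \<F>"
      by (cases "m = 0") (auto intro!: sets_Collect_finite_All')
    also have "{x \<in> \<Omega>. \<forall>i\<in>{..<m}. (x \<in> A i \<longleftrightarrow> i \<in> fst t) \<and> (x \<in> B i \<longleftrightarrow> i \<in> snd t)} = {x \<in> \<Omega>. h x = t}"
      using True by (cases t) (auto simp: h_def)
    finally show ?thesis .
  next
    case False
    then have empty: "{x \<in> \<Omega>. h x = t} = {}" by (auto simp: h_def)
    show ?thesis unfolding empty by (rule empty_sets)
  qed
  have pre: "{x \<in> \<Omega>. h x \<in> N} \<in> \<F>" for N
  proof -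
    have "(\<Union>t\<in>N \<inter> h ` \<Omega>. {x \<in> \<Omega>. h x = t}) \<in> \<F>" using fin fibre by (intro finite_UN) auto
    also have "(\<Union>t\<in>N \<inter> h ` \<Omega>. {x \<in> \<Omega>. h x = t}) = {x \<in> \<Omega>. h x \<in> N}" by auto
    finally show ?thesis .
  qed
  define f' where "f' N = f {x \<in> \<Omega>. h x \<in> N}" for N
  have "one_additive (Pow (h ` \<Omega>)) f'"
    unfolding one_additive_def
  proof (intro ballI impI)
    fix S T :: "(nat set \<times> nat set) set" assume "S \<inter> T = {}"
    then have "{x \<in> \<Omega>. h x \<in> S} \<inter> {x \<in> \<Omega>. h x \<in> T} = {}" by blast
    moreover have "{x \<in> \<Omega>. h x \<in> S \<union> T} = {x \<in> \<Omega>. h x \<in> S} \<union> {x \<in> \<Omega>. h x \<in> T}" by auto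
    ultimately show "norm (f' (S \<union> T) - f' S - f' T) \<le> 1"
      unfolding f'_def using one_additiveD[OF f pre[of S] pre[of T]] by presburger
  qed
  then have bound: "balanced_bound (Pow (h ` \<Omega>)) f' 200" using fin by (rule balanced_bound_finite)
  define A' where "A' i = {t \<in> h ` \<Omega>. i \<in> fst t}" for i
  define B' where "B' i = {t \<in> h ` \<Omega>. i \<in> snd t}" for i
  have f'AB: "f' (A' i) = f (A i)" "f' (B' i) = f (B i)" if i: "i < m" for i
  proof -
    have "{x \<in> \<Omega>. h x \<in> A' i} = A i" "{x \<in> \<Omega>. h x \<in> B' i} = B i"
      using AB i sets_into_space by (auto simp: A'_def B'_def h_def)
    then show "f' (A' i) = f (A i)" "f' (B' i) = f (B i)" by (auto simp: f'_def)
  qed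
  have "(\<Sum>i<m. f' (A' i) - f' (B' i)) \<le> real m * 200"
  proof (rule balanced_boundD[OF bound])
    fix t
    show "(\<Sum>i<m. indicator (A' i) t) = (\<Sum>i<m. indicator (B' i) t :: int)"
    proof (cases "t \<in> h ` \<Omega>")
      case True
      then obtain x where "t = h x" "x \<in> \<Omega>" by blast
      then have "(\<Sum>i<m. indicator (A' i) t) = (\<Sum>i<m. indicator (A i) x :: int)"
        "(\<Sum>i<m. indicator (B' i) t) = (\<Sum>i<m. indicator (B i) x :: int)"
        by (auto simp: A'_def B'_def h_def indicator_def intro!: sum.cong)
      then show ?thesis using bal by simp
    qed (simp add: A'_def B'_def)
  qed (auto simp: A'_def B'_def)
  then show "(\<Sum>i<m. f (A i) - f (B i)) \<le> real m * 200" by (simp add: f'AB)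
qed

text \<open>The oscillation bound is normalised at the empty set: there the additive map vanishes
  and \<open>\<bar>f {}\<bar> \<le> 1\<close>, which turns \<open>200\<close> into
  \<open>201\<close>.\<close>

theorem Kalton_Roberts:
  assumes alg: "algebra \<Omega> \<F>"
  shows "SVM_on \<F> TYPE(real) 201"
  unfolding SVM_on_def
proof (intro allI impI)
  interpret algebra \<Omega> \<F> by (rule alg)
  fix f :: "'a set \<Rightarrow> real" assume f: "one_additive \<F> f"
  obtain \<phi> :: "('a \<Rightarrow> int) \<Rightarrow> real" where add: "\<And>x y. \<phi> (x + y) = \<phi> x + \<phi> y"
    and osc: "\<And>C D. \<lbrakk>C \<in> \<F>; D \<in> \<F>\<rbrakk> \<Longrightarrow> (f C - \<phi> (indicator C)) - (f D - \<phi> (indicator D)) \<le> 200"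
    by (rule balanced_bound_imp_additive[OF balanced_bound_algebra[OF alg f]]) blast
  interpret \<phi>: Modules.additive \<phi> by unfold_locales (rule add)
  have "(indicator {} :: 'a \<Rightarrow> int) = 0" by (simp add: fun_eq_iff)
  then have "\<phi> (indicator {}) = 0" using \<phi>.zero by simp
  moreover have "\<bar>f {}\<bar> \<le> 1" using one_additiveD[OF f, of "{}" "{}"] by simp
  ultimately have "norm (f A - \<phi> (indicator A)) \<le> 201" if "A \<in> \<F>" for A
    using osc[of A "{}"] osc[of "{}" A] that by (simp add: abs_le_iff)
  moreover have "Measure_Space.additive \<F> (\<lambda>A. \<phi> (indicator A))"
    unfolding Measure_Space.additive_def
  proof (intro ballI impI)
    fix S T :: "'a set" assume "S \<inter> T = {}"
    then have "indicator (S \<union> T) = (indicator S + indicator T :: 'a \<Rightarrow> int)"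
      by (auto simp: fun_eq_iff indicator_def)
    then show "\<phi> (indicator (S \<union> T)) = \<phi> (indicator S) + \<phi> (indicator T)" by (simp add: add)
  qed
  ultimately show "\<exists>\<mu>. Measure_Space.additive \<F> \<mu> \<and> (\<forall>A\<in>\<F>. norm (f A - \<mu> A) \<le> 201)" by blast
qed

corollary Kalton_Roberts_constants_nonempty: "201 \<in> Kalton_Roberts_constants"
  using Kalton_Roberts by (auto simp: Kalton_Roberts_constants_def)

section \<open>Closed subspaces of Banach spaces\<close>

definition nspace_on :: "'a::real_normed_vector set \<Rightarrow> 'a nspace" where
  "nspace_on Z = \<lparr>carr = Z, vadd = (+), vzero = 0, vscale = scaleR, vnorm = norm\<rparr>"

lemma nspace_on_sel [simp]:
  "carr (nspace_on Z) = Z" "vadd (nspace_on Z) = (+)" "vzero (nspace_on Z) = 0"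
  "vscale (nspace_on Z) = scaleR" "vnorm (nspace_on Z) = norm"
  by (simp_all add: nspace_on_def)

lemma vdist_nspace_on: "\<lbrakk>x \<in> Z; y \<in> Z\<rbrakk> \<Longrightarrow> vdist (nspace_on Z) x y = dist x y"
  by (simp add: vdist_def dist_norm)

lemma normed_space_on_nspace_on: "subspace Z \<Longrightarrow> normed_space_on (nspace_on Z)"
  by unfold_locales
    (auto simp: subspace_0 subspace_add subspace_scale algebra_simps norm_triangle_ineq)

lemma Metric_space_nspace_on: "subspace Z \<Longrightarrow> Metric_space Z (vdist (nspace_on Z))"
  using normed_space_on.Metric_space[OF normed_space_on_nspace_on] by simp

lemma Banach_space_on_nspace_on:
  fixes Z :: "'a::banach set"
  assumes "subspace Z" "closed Z"
  shows "Banach_space_on (nspace_on Z)"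
proof -
  interpret M: Metric_space Z "vdist (nspace_on Z)" by (rule Metric_space_nspace_on[OF assms(1)])
  have "M.mcomplete"
    unfolding M.mcomplete_def
  proof (intro allI impI)
    fix s assume s: "M.MCauchy s"
    then have Z: "s n \<in> Z" for n unfolding M.MCauchy_def by auto
    have "Cauchy s"
    proof (rule metric_CauchyI)
      fix e :: real assume "0 < e"
      then obtain N where "\<And>m n. \<lbrakk>N \<le> m; N \<le> n\<rbrakk> \<Longrightarrow> vdist (nspace_on Z) (s m) (s n) < e"
        using s unfolding M.MCauchy_def by blast
      then show "\<exists>N. \<forall>m\<ge>N. \<forall>n\<ge>N. dist (s m) (s n) < e" using Z by (auto simp: vdist_nspace_on)
    qed
    then obtain l where l: "s \<longlonglongrightarrow> l" using Cauchy_convergent convergent_def by blast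
    then have "l \<in> Z" using assms(2) Z closed_sequentially by blast
    then have "limitin M.mtopology s l sequentially"
      using l Z unfolding M.limit_metric_sequentially LIMSEQ_def by (auto simp: vdist_nspace_on)
    then show "\<exists>x. limitin M.mtopology s x sequentially" by blast
  qed
  then show ?thesis by (simp add: Banach_space_on_def normed_space_on_nspace_on assms)
qed

lemma density_character_less_nspace_on:
  assumes "subspace Z" "D \<subseteq> Z" "Z \<subseteq> closure D" "|D| <o \<kappa>"
  shows "density_character_less (nspace_on Z) \<kappa>"
proof -
  interpret M: Metric_space Z "vdist (nspace_on Z)" by (rule Metric_space_nspace_on[OF assms(1)])
  have "\<exists>y\<in>D. vdist (nspace_on Z) x y < r" if "x \<in> Z" "0 < r" for x r
  proof -
    have "x \<in> closure D" using that(1) assms(3) by blast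
    then obtain y where y: "y \<in> D" "dist y x < r" using \<open>0 < r\<close> unfolding closure_approachable by blast
    have "vdist (nspace_on Z) x y = dist y x"
      using that(1) y(1) assms(2) by (simp add: vdist_nspace_on dist_commute subsetD)
    then show ?thesis using y by (intro bexI[of _ y]) simp_all
  qed
  then have "M.mtopology closure_of D = Z"
    unfolding M.metric_closure_of M.in_mball using assms(2) by blast
  then show ?thesis unfolding density_character_less_def using assms by auto
qed

lemma closed_subspace_nspace_on:
  assumes "subspace Z" "F \<subseteq> Z" "subspace F" "closed F"
  shows "closed_subspace (nspace_on Z) F"
proof -
  interpret M: Metric_space Z "vdist (nspace_on Z)" by (rule Metric_space_nspace_on[OF assms(1)])
  have "closedin M.mtopology F"
    unfolding M.metric_closedin_iff_sequentially_closed
  proof (intro conjI allI impI assms; elim conjE)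
    fix s l assume s: "range s \<subseteq> F" and "limitin M.mtopology s l sequentially"
    then have l: "l \<in> Z" "\<And>r. 0 < r \<Longrightarrow> \<exists>N. \<forall>n\<ge>N. s n \<in> Z \<and> vdist (nspace_on Z) (s n) l < r"
      unfolding M.limit_metric_sequentially by auto
    have "s \<longlonglongrightarrow> l"
    proof (rule metric_LIMSEQ_I)
      show "\<exists>N. \<forall>n\<ge>N. dist (s n) l < r" if "0 < r" for r
        using l(2)[OF that] l(1) by (metis vdist_nspace_on)
    qed
    then show "l \<in> F" using closed_sequentially[OF assms(4)] s by blast
  qed
  then show ?thesis
    unfolding closed_subspace_def using assms by (simp add: subspace_0 subspace_add subspace_scale)
qed

lemma norm_le_operator_norm:
  fixes T :: "'a::real_normed_vector \<Rightarrow> 'x::real_normed_vector"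
  assumes T: "bounded_operator (nspace_on Z) Z T" and z: "z \<in> Z"
  shows "norm (T z) \<le> operator_norm (nspace_on Z) Z T * norm z"
proof -
  obtain b where b: "\<And>x. x \<in> Z \<Longrightarrow> norm (T x) \<le> b * norm x" using T unfolding bounded_operator_def nspace_on_sel by blast
  \<comment> \<open>\<open>b\<close> may be negative when \<open>Z\<close> is the zero space,
    whereas the quotient at zero is \<open>0\<close>.\<close>
  have "norm (T x) / norm x \<le> max b 0" if "x \<in> Z" for x
  proof (cases "x = 0")
    case False
    then show ?thesis using b[OF that] by (simp add: divide_le_eq max_mult_distrib_right)
  qed simp
  then have "bdd_above ((\<lambda>x. norm (T x) / norm x) ` Z)" by (intro bdd_aboveI2)
  then have "norm (T z) / norm z \<le> operator_norm (nspace_on Z) Z T"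
    unfolding operator_norm_def using z by (auto intro: cSUP_upper)
  then show ?thesis using b[OF z] by (cases "z = 0") (auto simp: divide_le_eq)
qed

section \<open>Cardinalities and density\<close>

lemma ordLess_natLeq:
  assumes "Card_order \<kappa>" "natLeq <o \<kappa>"
  shows "infinite (Field \<kappa>)" "|UNIV :: nat set| <o \<kappa>"
proof -
  show "|UNIV :: nat set| <o \<kappa>" using card_of_nat assms(2) by (rule ordIso_ordLess_trans)
  have "natLeq \<le>o |Field \<kappa>|"
    using assms card_of_Field_ordIso ordIso_symmetric ordLeq_ordIso_trans ordLess_imp_ordLeq by blast
  then show "infinite (Field \<kappa>)" using infinite_iff_natLeq_ordLeq by blast
qed

text \<open>Adding the naturals to \<open>S\<close> makes the bound infinite even if
  \<open>S\<close> is finite, and it stays below an uncountable cardinal.\<close>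

lemma card_of_UN_ordLess:
  assumes \<kappa>: "Card_order \<kappa>" "natLeq <o \<kappa>" and "|S| <o \<kappa>"
    and "\<And>n. |A n| \<le>o |(UNIV :: nat set) <+> S|"
  shows "|\<Union>n::nat. A n| <o \<kappa>"
proof -
  have "|\<Union>n::nat. A n| \<le>o |(UNIV :: nat set) <+> S|"
    by (rule card_of_UNION_ordLeq_infinite) (use assms(4) card_of_Plus1 in auto)
  also have "|(UNIV :: nat set) <+> S| <o \<kappa>"
    using ordLess_natLeq[OF \<kappa>] assms(3) by (intro card_of_Plus_ordLess_infinite_Field \<kappa>(1))
  finally show ?thesis .
qed

text \<open>\<open>D\<close> consists of all rational combinations of \<open>S\<close>, built by
  adding one term at a time, so that the cardinality bound follows by induction on the number of
  terms. Its closure admits real scalars because these are limits of rationals.\<close>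

lemma closed_span_density:
  fixes S :: "'a::real_normed_vector set"
  assumes \<kappa>: "Card_order \<kappa>" "natLeq <o \<kappa>" and S: "|S| <o \<kappa>"
  obtains D where "S \<subseteq> closure D" "subspace (closure D)" "|D| <o \<kappa>"
proof -
  define step where "step = (\<lambda>((q, s), d). real_of_rat q *\<^sub>R s + d :: 'a)"
  define L where "L = rec_nat {0} (\<lambda>_ X. step ` ((UNIV \<times> S) \<times> X))"
  have L: "L 0 = {0}" "L (Suc n) = step ` ((UNIV \<times> S) \<times> L n)" for n by (simp_all add: L_def)
  let ?C = "(UNIV :: nat set) <+> S"
  have inf: "infinite ?C" by simp
  have "|L n| \<le>o |?C|" for n
  proof (induction n)
    case 0
    have "|{0 :: 'a}| \<le>o |?C|" by (rule card_of_singl_ordLeq) (use inf in auto)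
    then show ?case by (simp add: L)
  next
    case (Suc n)
    have "|UNIV :: rat set| \<le>o |UNIV :: nat set|"
      using inj_to_nat card_of_ordLeq by blast
    then have rat: "|UNIV :: rat set| \<le>o |?C|" using card_of_Plus1 ordLeq_transitive by blast
    have "|(UNIV :: rat set) \<times> S| \<le>o |?C|"
      by (rule card_of_Times_ordLeq_infinite_Field)
        (use rat card_of_Plus2 in \<open>auto simp: inf Field_card_of card_of_card_order_on\<close>)
    then have "|((UNIV :: rat set) \<times> S) \<times> L n| \<le>o |?C|"
      by (rule card_of_Times_ordLeq_infinite_Field[OF _ _ Suc, rotated])
        (auto simp: inf Field_card_of card_of_card_order_on)
    then show ?case unfolding L using card_of_image ordLeq_transitive by blast
  qed
  then have card: "|\<Union>n. L n| <o \<kappa>" by (intro card_of_UN_ordLess[OF \<kappa> S])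
  define D where "D = (\<Union>n. L n)"
  have 0: "0 \<in> D" using L(1) by (auto simp: D_def)
  have step: "real_of_rat q *\<^sub>R s + d \<in> D" if "s \<in> S" "d \<in> D" for q s d
  proof -
    obtain n where "d \<in> L n" using \<open>d \<in> D\<close> by (auto simp: D_def)
    then have "step ((q, s), d) \<in> L (Suc n)" unfolding L using \<open>s \<in> S\<close> by blast
    then show ?thesis by (auto simp: D_def step_def)
  qed
  have induct: "P d" if "d \<in> D" "P 0" "\<And>q s d. \<lbrakk>s \<in> S; d \<in> D; P d\<rbrakk> \<Longrightarrow> P (real_of_rat q *\<^sub>R s + d)" for P d
  proof -
    have "d \<in> L n \<Longrightarrow> P d" for n
    proof (induction n arbitrary: d)
      case (Suc n)
      then obtain q s d' where d': "d = real_of_rat q *\<^sub>R s + d'" "s \<in> S" "d' \<in> L n"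
        unfolding L step_def by auto
      then show ?case using that(3)[of s d' q] Suc.IH[of d'] by (auto simp: D_def)
    qed (simp add: L that)
    then show ?thesis using that(1) by (auto simp: D_def)
  qed
  have add: "x + y \<in> D" if "x \<in> D" "y \<in> D" for x y
  proof (rule induct[OF \<open>x \<in> D\<close>])
    show "real_of_rat q *\<^sub>R s + d + y \<in> D" if "s \<in> S" "d + y \<in> D" for q s d
      using step[OF that] by (simp add: add.assoc)
  qed (use \<open>y \<in> D\<close> in simp)
  have scale: "real_of_rat q *\<^sub>R x \<in> D" if "x \<in> D" for x q
  proof (rule induct[OF that])
    show "real_of_rat q *\<^sub>R (real_of_rat r *\<^sub>R s + d) \<in> D" if "s \<in> S" "real_of_rat q *\<^sub>R d \<in> D" for r s d
      using step[OF that, of "q * r"] by (simp add: scaleR_add_right of_rat_mult)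
  qed (simp add: 0)
  have "S \<subseteq> D" using step[OF _ 0, of _ 1] by auto
  then have "S \<subseteq> closure D" using closure_subset by blast
  moreover have "subspace (closure D)"
  proof (rule subspaceI)
    show "0 \<in> closure D" using 0 closure_subset by blast
    fix x assume "x \<in> closure D"
    then obtain s where s: "\<And>n. s n \<in> D" "s \<longlonglongrightarrow> x" using closure_sequential by blast
    show "x + y \<in> closure D" if "y \<in> closure D" for y
    proof -
      obtain t where t: "\<And>n. t n \<in> D" "t \<longlonglongrightarrow> y" using \<open>y \<in> closure D\<close> closure_sequential by blast
      have "(\<lambda>n. s n + t n) \<longlonglongrightarrow> x + y" using s(2) t(2) by (rule tendsto_add)
      then show ?thesis
        unfolding closure_sequential using add s(1) t(1) by (intro exI[of _ "\<lambda>n. s n + t n"]) simp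
    qed
    show "c *\<^sub>R x \<in> closure D" for c
    proof -
      have "\<exists>q. \<bar>real_of_rat q - c\<bar> < 1 / Suc n" for n
      proof -
        obtain q where "c - 1 / Suc n < real_of_rat q" "real_of_rat q < c"
          using of_rat_dense[of "c - 1 / Suc n" c] by auto
        then have "\<bar>real_of_rat q - c\<bar> < 1 / Suc n" by linarith
        then show ?thesis ..
      qed
      then have "\<forall>n. \<exists>q. \<bar>real_of_rat q - c\<bar> < 1 / Suc n" ..
      from choice[OF this] obtain q where "\<forall>n. \<bar>real_of_rat (q n) - c\<bar> < 1 / Suc n" ..
      then have q: "\<bar>real_of_rat (q n) - c\<bar> < 1 / Suc n" for n by blast
      have "(\<lambda>n. real_of_rat (q n) - c) \<longlonglongrightarrow> 0"
      proof (rule Lim_null_comparison[OF _ LIMSEQ_inverse_real_of_nat])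
        show "\<forall>\<^sub>F n in sequentially. norm (real_of_rat (q n) - c) \<le> inverse (real (Suc n))"
          using q by (simp add: inverse_eq_divide less_imp_le)
      qed
      then have "(\<lambda>n. real_of_rat (q n) *\<^sub>R s n) \<longlonglongrightarrow> c *\<^sub>R x"
        using s(2) by (intro tendsto_scaleR) (rule LIM_zero_cancel)
      then show ?thesis
        unfolding closure_sequential using scale s(1)
        by (intro exI[of _ "\<lambda>n. real_of_rat (q n) *\<^sub>R s n"]) simp
    qed
  qed
  ultimately show thesis using that card by (simp add: D_def)
qed

section \<open>Countable unions under uncountable cofinality\<close>

lemma uncountable_cofinality_natLeq:
  assumes "Card_order \<kappa>" "uncountable_cofinality \<kappa>"
  shows "natLeq <o \<kappa>"
proof (rule ccontr)
  assume "\<not> natLeq <o \<kappa>"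
  then have "\<kappa> \<le>o natLeq"
    using not_ordLess_iff_ordLeq[OF card_order_on_well_order_on[OF assms(1)] natLeq_Well_order] by blast
  with card_of_Field_ordIso[OF assms(1)] have "|Field \<kappa>| \<le>o natLeq" by (rule ordIso_ordLeq_trans)
  then have "|Field \<kappa>| \<le>o |UNIV :: nat set|"
    by (rule ordLeq_ordIso_trans[OF _ ordIso_symmetric[OF card_of_nat]])
  then obtain f :: "_ \<Rightarrow> nat" where "inj_on f (Field \<kappa>)" unfolding card_of_ordLeq[symmetric] by blast
  then have "countable (Field \<kappa>)" by (rule countableI)
  moreover have "infinite (Field \<kappa>)" using assms(2) by (simp add: uncountable_cofinality_def)
  \<comment> \<open>An infinite cardinal is a limit order, so its field has no largest element and
    is cofinal in itself; here it would be a countable cofinal set.\<close>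
  then have "cofinal (Field \<kappa>) \<kappa>"
    using infinite_Card_order_limit[OF assms(1)] by (auto simp: cofinal_def)
  ultimately show False using assms(2) unfolding uncountable_cofinality_def by blast
qed

text \<open>Each \<open>A n\<close> embeds into the initial segment below some \<open>a n\<close>.
  These countably many elements are not cofinal, so a single \<open>b\<close> dominates them, and
  the union is no larger than the naturals together with the segment below \<open>b\<close>, which
  is smaller than \<open>\<kappa>\<close>.\<close>

lemma countable_UN_ordLess:
  fixes \<kappa> :: "'k rel" and A :: "nat \<Rightarrow> 'a set"
  assumes \<kappa>: "Card_order \<kappa>" "uncountable_cofinality \<kappa>" and A: "\<And>n. |A n| <o \<kappa>"
  shows "|\<Union>n. A n| <o \<kappa>"
proof -
  have wo: "Well_order \<kappa>" using \<kappa>(1) by (rule card_order_on_well_order_on)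
  have "\<exists>a\<in>Field \<kappa>. |A n| \<le>o |underS \<kappa> a|" for n
  proof -
    obtain a where a: "a \<in> Field \<kappa>" "|A n| =o Restr \<kappa> (underS \<kappa> a)"
      using A[of n] ordLess_iff_ordIso_Restr[OF wo card_of_Well_order] by blast
    have "|A n| =o |Field (Restr \<kappa> (underS \<kappa> a))|"
      using card_of_cong[OF a(2)] by (simp add: Field_card_of)
    moreover have "|Field (Restr \<kappa> (underS \<kappa> a))| \<le>o |underS \<kappa> a|"
      by (rule card_of_mono1) (auto simp: Field_def)
    ultimately show ?thesis using a(1) ordIso_ordLeq_trans by blast
  qed
  then obtain a where a: "\<And>n. a n \<in> Field \<kappa>" "\<And>n. |A n| \<le>o |underS \<kappa> (a n)|" by metis
  have "\<not> cofinal (range a) \<kappa>"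
    using \<kappa>(2) a(1) unfolding uncountable_cofinality_def by blast
  then obtain b where b: "b \<in> Field \<kappa>" "\<And>n. b = a n \<or> (b, a n) \<notin> \<kappa>"
    unfolding cofinal_def by blast
  interpret r: wo_rel \<kappa> using wo by (simp add: wo_rel_def)
  have "(a n, b) \<in> \<kappa>" for n
    using r.TOTALS a(1)[of n] b(1) b(2)[of n] by blast
  then have "underS \<kappa> (a n) \<subseteq> underS \<kappa> b" for n
    by (intro underS_incr r.TRANS r.ANTISYM)
  then have "|A n| \<le>o |underS \<kappa> b|" for n
    using ordLeq_transitive[OF a(2) card_of_mono1] by blast
  then have "|A n| \<le>o |(UNIV :: nat set) <+> underS \<kappa> b|" for n
    by (rule ordLeq_transitive[OF _ card_of_Plus2])
  then show ?thesis
    by (intro card_of_UN_ordLess[OF \<kappa>(1) uncountable_cofinality_natLeq[OF \<kappa>] card_of_underS[OF \<kappa>(1) b(1)]])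
qed

section \<open>The SVM property of injective spaces\<close>

definition of_bounded :: "('a \<Rightarrow> real) \<Rightarrow> ('a discrete \<Rightarrow>\<^sub>C real)" where
  "of_bounded h = Bcontfun (h \<circ> of_discrete)"

text \<open>On a discrete domain every function is continuous, so a bound alone puts
  \<open>h\<close> into the space of bounded continuous functions.\<close>

lemma apply_of_bounded:
  assumes "\<And>x. \<bar>h x\<bar> \<le> b"
  shows "apply_bcontfun (of_bounded h) d = h (of_discrete d)"
proof -
  have "bounded (range (h \<circ> of_discrete))" using assms by (intro boundedI[of _ b]) auto
  then have "h \<circ> of_discrete \<in> bcontfun"
    by (simp add: bcontfun_def continuous_on_open_vimage open_discrete)
  then show ?thesis by (simp add: of_bounded_def Bcontfun_inverse)
qed

instance bcontfun :: (metric_space, banach) banach ..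

text \<open>The coordinate of \<open>J\<close> at \<open>y\<close> is a functional that norms
  \<open>y\<close>, so all coordinates together recover the norm. Each has norm at most one and
  hence preserves one-additivity, which lets the scalar theorem act coordinatewise. The
  approximation belongs to the conclusion because it depends on how \<open>J\<close> is
  built.\<close>

lemma isometric_embedding:
  obtains J :: "'x::real_normed_vector \<Rightarrow> ('x discrete \<Rightarrow>\<^sub>C real)"
  where "linear J" "\<And>x. norm (J x) = norm x"
    "\<And>K \<Omega> (\<F> :: 'p set set) \<nu>. \<lbrakk>K \<in> Kalton_Roberts_constants; algebra \<Omega> \<F>; one_additive \<F> \<nu>\<rbrakk> \<Longrightarrow>
       \<exists>\<mu>. Measure_Space.additive \<F> \<mu> \<and> (\<forall>A\<in>\<F>. norm (J (\<nu> A) - \<mu> A) \<le> K)"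
proof -
  have "\<forall>y. \<exists>\<phi> :: 'x \<Rightarrow> real. linear \<phi> \<and> (\<forall>x. \<bar>\<phi> x\<bar> \<le> norm x) \<and> \<phi> y = norm y"
  proof
    fix y :: 'x
    obtain \<phi> :: "'x \<Rightarrow> real" where "linear \<phi>" "\<And>x. \<bar>\<phi> x\<bar> \<le> norm x" "\<phi> y = norm y"
      by (rule norming_functional[of y]) blast
    then show "\<exists>\<phi> :: 'x \<Rightarrow> real. linear \<phi> \<and> (\<forall>x. \<bar>\<phi> x\<bar> \<le> norm x) \<and> \<phi> y = norm y" by blast
  qed
  from choice[OF this] obtain \<phi> :: "'x \<Rightarrow> 'x \<Rightarrow> real"
    where "\<forall>y. linear (\<phi> y) \<and> (\<forall>x. \<bar>\<phi> y x\<bar> \<le> norm x) \<and> \<phi> y y = norm y" ..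
  then have \<phi>: "\<And>y. linear (\<phi> y)" "\<And>y x. \<bar>\<phi> y x\<bar> \<le> norm x" "\<And>y. \<phi> y y = norm y" by auto
  define J where "J x = of_bounded (\<lambda>y. \<phi> y x)" for x
  have J: "apply_bcontfun (J x) d = \<phi> (of_discrete d) x" for x d
    unfolding J_def by (rule apply_of_bounded) (rule \<phi>(2))
  show thesis
  proof (rule that)
    show "linear J"
      by (rule linearI; rule bcontfun_eqI) (simp_all add: J linear_add[OF \<phi>(1)] linear_scale[OF \<phi>(1)])
    show "norm (J x) = norm x" for x
    proof (rule antisym)
      show "norm (J x) \<le> norm x" by (rule norm_bound) (simp add: J \<phi>(2))
      show "norm x \<le> norm (J x)"
        using norm_bounded[of "J x" "discrete x"] \<phi>(3)[of x] by (simp add: J discrete_inverse)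
    qed
  next
    fix K \<Omega> and \<F> :: "'p set set" and \<nu> :: "'p set \<Rightarrow> 'x"
    assume K: "K \<in> Kalton_Roberts_constants" and alg: "algebra \<Omega> \<F>" and \<nu>: "one_additive \<F> \<nu>"
    have "\<exists>m. Measure_Space.additive \<F> m \<and> (\<forall>A\<in>\<F>. \<bar>\<phi> y (\<nu> A) - m A\<bar> \<le> K)" for y
    proof -
      have "one_additive \<F> (\<lambda>A. \<phi> y (\<nu> A))"
        unfolding one_additive_def
      proof (intro ballI impI)
        fix A B assume "A \<in> \<F>" "B \<in> \<F>" "A \<inter> B = {}"
        then show "norm (\<phi> y (\<nu> (A \<union> B)) - \<phi> y (\<nu> A) - \<phi> y (\<nu> B)) \<le> 1"
          using \<phi>(2)[of y "\<nu> (A \<union> B) - \<nu> A - \<nu> B"] one_additiveD[OF \<nu>, of A B]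
          by (simp add: linear_diff[OF \<phi>(1)])
      qed
      then show ?thesis using Kalton_Roberts_any_algebra[OF K alg] unfolding SVM_on_def by auto
    qed
    then obtain m where m: "\<And>y. Measure_Space.additive \<F> (m y)"
      "\<And>y A. A \<in> \<F> \<Longrightarrow> \<bar>\<phi> y (\<nu> A) - m y A\<bar> \<le> K" by metis
    define \<mu> where "\<mu> A = of_bounded (\<lambda>y. m y A)" for A
    \<comment> \<open>At a fixed set \<open>A\<close> the scalar measures are bounded over all
      coordinates, each being within \<open>K\<close> of \<open>\<phi> y (\<nu> A)\<close>.\<close>
    have \<mu>: "apply_bcontfun (\<mu> A) d = m (of_discrete d) A" if "A \<in> \<F>" for A d
      unfolding \<mu>_def
    proof (rule apply_of_bounded)
      show "\<bar>m y A\<bar> \<le> norm (\<nu> A) + K" for y using m(2)[OF that, of y] \<phi>(2)[of y "\<nu> A"] by linarith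
    qed
    interpret algebra \<Omega> \<F> by (rule alg)
    have "Measure_Space.additive \<F> \<mu>"
      unfolding Measure_Space.additive_def
    proof (intro ballI impI bcontfun_eqI)
      fix A B d assume "A \<in> \<F>" "B \<in> \<F>" "A \<inter> B = {}"
      then show "apply_bcontfun (\<mu> (A \<union> B)) d = apply_bcontfun (\<mu> A + \<mu> B) d"
        using m(1)[of "of_discrete d"] by (simp add: \<mu> Un Measure_Space.additive_def)
    qed
    moreover have "norm (J (\<nu> A) - \<mu> A) \<le> K" if "A \<in> \<F>" for A
      by (rule norm_bound) (simp add: J \<mu> m(2) that)
    ultimately show "\<exists>\<mu>. Measure_Space.additive \<F> \<mu> \<and> (\<forall>A\<in>\<F>. norm (J (\<nu> A) - \<mu> A) \<le> K)" by blast
  qed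
qed

section \<open>Pulling measures back through an extension of the inverse embedding\<close>

lemma linear_isometry_inj:
  fixes J :: "'x::real_normed_vector \<Rightarrow> 'y::real_normed_vector"
  assumes "linear J" "\<And>x. norm (J x) = norm x" shows "inj J"
  unfolding linear_injective_0[OF assms(1)] using assms(2) by (metis norm_eq_zero)

text \<open>The operator to be extended inverts an isometry, so its norm is at most one. Its domain
  is closed because the isometric image of a complete space is complete; \<open>Z\<close> comes from
  \<open>closed_span_density\<close>, which keeps its density character below
  \<open>\<kappa>\<close>.\<close>

lemma extension_problem:
  fixes J :: "'x::banach \<Rightarrow> 'y::banach"
  assumes \<kappa>: "Card_order \<kappa>" "natLeq <o \<kappa>" and J: "linear J" "\<And>x. norm (J x) = norm x"
    and S: "|S| <o \<kappa>"
  obtains Z where "S \<subseteq> Z" "subspace Z"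
    "Banach_space_on (nspace_on Z)" "density_character_less (nspace_on Z) \<kappa>"
    "closed_subspace (nspace_on Z) (Z \<inter> range J)"
    "bounded_operator (nspace_on Z) (Z \<inter> range J) (inv J)"
    "operator_norm (nspace_on Z) (Z \<inter> range J) (inv J) \<le> 1"
proof -
  obtain D where D: "S \<subseteq> closure D" "subspace (closure D)" "|D| <o \<kappa>"
    by (rule closed_span_density[OF \<kappa> S]) blast
  let ?Z = "closure D" and ?F = "closure D \<inter> range J"
  have inj: "inj J" using J by (rule linear_isometry_inj)
  then have inv: "inv J (J x) = x" for x by simp
  have bl: "bounded_linear J" using J by (intro bounded_linear_intro[of J 1]) (auto simp: linear_add linear_scale)
  have "complete (range J)"
    using J by (intro complete_isometric_image[of 1 UNIV J] bl complete_UNIV) auto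
  then have "closed ?F" by (intro closed_Int closed_closure complete_imp_closed)
  moreover have F: "subspace ?F"
    using D(2) J(1) by (intro subspace_inter linear_subspace_image) auto
  ultimately have "closed_subspace (nspace_on ?Z) ?F" using D(2) by (intro closed_subspace_nspace_on) auto
  moreover have "bounded_operator (nspace_on ?Z) ?F (inv J)"
    unfolding bounded_operator_def
  proof (intro conjI ballI allI exI[of _ 1])
    show "inv J (vadd (nspace_on ?Z) x y) = inv J x + inv J y" if "x \<in> ?F" "y \<in> ?F" for x y
      using that inv by (auto simp flip: linear_add[OF J(1)])
    show "inv J (vscale (nspace_on ?Z) a x) = a *\<^sub>R inv J x" if "x \<in> ?F" for a x
      using that inv by (auto simp flip: linear_scale[OF J(1)])
    show "norm (inv J x) \<le> 1 * vnorm (nspace_on ?Z) x" if "x \<in> ?F" for x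
      using that inv J(2) by auto
  qed
  moreover have "operator_norm (nspace_on ?Z) ?F (inv J) \<le> 1"
    unfolding operator_norm_def
  proof (rule cSUP_least)
    show "?F \<noteq> {}" using subspace_0[OF F] by blast
    show "norm (inv J x) / vnorm (nspace_on ?Z) x \<le> 1" if "x \<in> ?F" for x
      using that inv J(2) by (auto simp: divide_le_eq)
  qed
  ultimately show thesis
    using D closure_subset
    by (intro that[of ?Z] Banach_space_on_nspace_on density_character_less_nspace_on) auto
qed

text \<open>\<open>T\<close> undoes \<open>J\<close> on the values of \<open>\<nu>\<close> and maps
  the measure \<open>\<mu>\<close> to a measure; distances grow at most by the factor
  \<open>b\<close>.\<close>

lemma SVM_transfer_operator:
  fixes J :: "'x::real_normed_vector \<Rightarrow> 'y::real_normed_vector" and T :: "'y \<Rightarrow> 'x"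
  assumes Z: "subspace Z" and T: "bounded_operator (nspace_on Z) Z T"
    and b: "\<And>z. z \<in> Z \<Longrightarrow> norm (T z) \<le> b * norm z" "0 \<le> b"
    and TJ: "\<And>z. z \<in> Z \<inter> range J \<Longrightarrow> T z = inv J z" and J: "inj J"
    and in_Z: "(\<lambda>A. J (\<nu> A)) ` \<F> \<union> \<mu> ` \<F> \<subseteq> Z"
    and \<mu>: "Measure_Space.additive \<F> \<mu>" "\<And>A. A \<in> \<F> \<Longrightarrow> norm (J (\<nu> A) - \<mu> A) \<le> K"
  shows "\<exists>\<mu>'. Measure_Space.additive \<F> \<mu>' \<and> (\<forall>A\<in>\<F>. norm (\<nu> A - \<mu>' A) \<le> b * K)"
proof (intro exI conjI ballI)
  have add: "T (x + y) = T x + T y" and scale: "T (a *\<^sub>R x) = a *\<^sub>R T x" if "x \<in> Z" "y \<in> Z" for x y a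
    using T that by (simp_all add: bounded_operator_def)
  show "Measure_Space.additive \<F> (\<lambda>A. T (\<mu> A))"
    using \<mu>(1) in_Z by (auto simp: Measure_Space.additive_def add image_subset_iff)
  fix A assume A: "A \<in> \<F>"
  have JA: "J (\<nu> A) \<in> Z" "\<mu> A \<in> Z" using in_Z A by auto
  have "\<nu> A = T (J (\<nu> A))" using TJ[of "J (\<nu> A)"] JA J by simp
  moreover have "T (J (\<nu> A) - \<mu> A) = T (J (\<nu> A)) - T (\<mu> A)"
    using add[OF JA(1) subspace_scale[OF Z JA(2), of "-1"]] scale[OF JA(2) JA(2), of "-1"] by simp
  ultimately have "norm (\<nu> A - T (\<mu> A)) \<le> b * norm (J (\<nu> A) - \<mu> A)"
    using b(1)[OF subspace_diff[OF Z JA]] by simp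
  also have "\<dots> \<le> b * K" using \<mu>(2)[OF A] b(2) by (rule mult_left_mono)
  finally show "norm (\<nu> A - T (\<mu> A)) \<le> b * K" .
qed

lemma card_of_images_ordLess:
  assumes \<kappa>: "Card_order \<kappa>" "natLeq <o \<kappa>" and "|\<F>| <o \<kappa>"
  shows "|f ` \<F> \<union> g ` \<F>| <o \<kappa>"
proof -
  have "|f ` \<F>| <o \<kappa>" "|g ` \<F>| <o \<kappa>" using assms(3) card_of_image ordLeq_ordLess_trans by blast+
  then show ?thesis
    using ordLess_natLeq[OF \<kappa>] \<kappa>(1) by (intro card_of_Un_ordLess_infinite_Field)
qed

theorem lambda_injective_SVM_constants:
  fixes \<kappa> :: "'k rel"
  assumes \<kappa>: "Card_order \<kappa>" "natLeq <o \<kappa>" and inj: "lambda_injective l \<kappa> TYPE('x::banach)" "0 \<le> l"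
    and K: "K \<in> Kalton_Roberts_constants"
  shows "l * K \<in> SVM_constants \<kappa> TYPE('x)"
  unfolding SVM_constants_def SVM_on_def
proof (intro CollectI conjI allI impI; (elim conjE)?)
  have "0 \<le> K" using K by (simp add: Kalton_Roberts_constants_def)
  then show "0 \<le> l * K" using inj(2) by simp
  fix \<Omega> and \<F> :: "'k set set" and \<nu> :: "'k set \<Rightarrow> 'x"
  assume alg: "algebra \<Omega> \<F>" and card: "|\<F>| <o \<kappa>" and \<nu>: "one_additive \<F> \<nu>"
  obtain J :: "'x \<Rightarrow> ('x discrete \<Rightarrow>\<^sub>C real)" where J: "linear J" "\<And>x. norm (J x) = norm x"
    and ex: "\<And>K \<Omega> (\<F> :: 'k set set) \<nu>. \<lbrakk>K \<in> Kalton_Roberts_constants; algebra \<Omega> \<F>; one_additive \<F> \<nu>\<rbrakk> \<Longrightarrow>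
       \<exists>\<mu>. Measure_Space.additive \<F> \<mu> \<and> (\<forall>A\<in>\<F>. norm (J (\<nu> A) - \<mu> A) \<le> K)"
    by (rule isometric_embedding) blast
  obtain \<mu> where \<mu>: "Measure_Space.additive \<F> \<mu>" "\<And>A. A \<in> \<F> \<Longrightarrow> norm (J (\<nu> A) - \<mu> A) \<le> K"
    using ex[OF K alg \<nu>] by blast
  obtain Z where Z: "(\<lambda>A. J (\<nu> A)) ` \<F> \<union> \<mu> ` \<F> \<subseteq> Z" "subspace Z"
    and E: "Banach_space_on (nspace_on Z)" "density_character_less (nspace_on Z) \<kappa>"
      "closed_subspace (nspace_on Z) (Z \<inter> range J)"
      "bounded_operator (nspace_on Z) (Z \<inter> range J) (inv J)"
    and n: "operator_norm (nspace_on Z) (Z \<inter> range J) (inv J) \<le> 1"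
    by (rule extension_problem[OF \<kappa> J card_of_images_ordLess[OF \<kappa> card]]) blast
  \<comment> \<open>\<open>Z\<close> lies in a type of bounded functions rather than in
    \<open>nat \<Rightarrow> 'k\<close>, so the hypothesis is applied in its form for arbitrary
    types.\<close>
  obtain T where T: "bounded_operator (nspace_on Z) Z T" "\<And>z. z \<in> Z \<inter> range J \<Longrightarrow> T z = inv J z"
    "operator_norm (nspace_on Z) Z T \<le> l * operator_norm (nspace_on Z) (Z \<inter> range J) (inv J)"
    using lambda_injective_any_space[OF \<kappa>(1) inj(1) E] by auto
  have "operator_norm (nspace_on Z) Z T \<le> l" using T(3) mult_left_mono[OF n inj(2)] by simp
  then have "norm (T z) \<le> l * norm z" if "z \<in> Z" for z
    using norm_le_operator_norm[OF T(1) that] mult_right_mono[of _ l "norm z"] by (meson norm_ge_zero order_trans)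
  then show "\<exists>\<mu>. Measure_Space.additive \<F> \<mu> \<and> (\<forall>A\<in>\<F>. norm (\<nu> A - \<mu> A) \<le> l * K)"
    by (rule SVM_transfer_operator[OF Z(2) T(1) _ inj(2) T(2) linear_isometry_inj[OF J] Z(1) \<mu>])
qed

text \<open>If every integer constant fails, there are countably many counterexamples. They share
  one space \<open>Z\<close>, small enough by \<open>countable_UN_ordLess\<close>, and one extension
  \<open>T\<close>, whose bound does not depend on \<open>n\<close> and so contradicts the
  counterexample for a large \<open>n\<close>.\<close>

theorem cardinal_injective_SVM_property:
  fixes \<kappa> :: "'k rel"
  assumes \<kappa>: "Card_order \<kappa>" "uncountable_cofinality \<kappa>" and inj: "cardinal_injective \<kappa> TYPE('x::banach)"
    and K: "K \<in> Kalton_Roberts_constants"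
  shows "SVM_property \<kappa> TYPE('x)"
proof (rule ccontr)
  assume fails: "\<not> SVM_property \<kappa> TYPE('x)"
  have nat: "natLeq <o \<kappa>" using \<kappa> by (rule uncountable_cofinality_natLeq)
  have "\<exists>\<Omega> (\<F> :: 'k set set) (\<nu> :: 'k set \<Rightarrow> 'x). algebra \<Omega> \<F> \<and> |\<F>| <o \<kappa> \<and> one_additive \<F> \<nu> \<and>
      \<not> (\<exists>\<mu>. Measure_Space.additive \<F> \<mu> \<and> (\<forall>A\<in>\<F>. norm (\<nu> A - \<mu> A) \<le> real n))" for n
  proof -
    have "real n \<notin> SVM_constants \<kappa> TYPE('x)" using fails by (auto simp: SVM_property_def)
    then show ?thesis unfolding SVM_constants_def SVM_on_def by auto
  qed
  then obtain \<Omega> and \<F> :: "nat \<Rightarrow> 'k set set" and \<nu> :: "nat \<Rightarrow> 'k set \<Rightarrow> 'x"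
    where \<F>: "\<And>n. algebra (\<Omega> n) (\<F> n)" "\<And>n. |\<F> n| <o \<kappa>" and \<nu>: "\<And>n. one_additive (\<F> n) (\<nu> n)"
    and far: "\<And>n. \<not> (\<exists>\<mu>. Measure_Space.additive (\<F> n) \<mu> \<and> (\<forall>A\<in>\<F> n. norm (\<nu> n A - \<mu> A) \<le> real n))"
    by metis
  obtain J :: "'x \<Rightarrow> ('x discrete \<Rightarrow>\<^sub>C real)" where J: "linear J" "\<And>x. norm (J x) = norm x"
    and ex: "\<And>K \<Omega> (\<F> :: 'k set set) \<nu>. \<lbrakk>K \<in> Kalton_Roberts_constants; algebra \<Omega> \<F>; one_additive \<F> \<nu>\<rbrakk> \<Longrightarrow>
       \<exists>\<mu>. Measure_Space.additive \<F> \<mu> \<and> (\<forall>A\<in>\<F>. norm (J (\<nu> A) - \<mu> A) \<le> K)"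
    by (rule isometric_embedding) blast
  obtain \<mu> where \<mu>: "\<And>n. Measure_Space.additive (\<F> n) (\<mu> n)"
    "\<And>n A. A \<in> \<F> n \<Longrightarrow> norm (J (\<nu> n A) - \<mu> n A) \<le> K"
    using ex[OF K \<F>(1) \<nu>] by metis
  define S where "S n = (\<lambda>A. J (\<nu> n A)) ` \<F> n \<union> \<mu> n ` \<F> n" for n
  have "|\<Union>n. S n| <o \<kappa>"
    unfolding S_def by (intro countable_UN_ordLess[OF \<kappa>] card_of_images_ordLess[OF \<kappa>(1) nat] \<F>(2))
  then obtain Z where Z: "(\<Union>n. S n) \<subseteq> Z" "subspace Z"
    and E: "Banach_space_on (nspace_on Z)" "density_character_less (nspace_on Z) \<kappa>"
      "closed_subspace (nspace_on Z) (Z \<inter> range J)"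
      "bounded_operator (nspace_on Z) (Z \<inter> range J) (inv J)"
    by (rule extension_problem[OF \<kappa>(1) nat J]) blast
  obtain T where T: "bounded_operator (nspace_on Z) Z T" "\<And>z. z \<in> Z \<inter> range J \<Longrightarrow> T z = inv J z"
    using cardinal_injective_any_space[OF \<kappa>(1) inj E] by auto
  obtain b where b: "\<And>z. z \<in> Z \<Longrightarrow> norm (T z) \<le> b * norm z"
    using T(1) unfolding bounded_operator_def nspace_on_sel by blast
  have b': "norm (T z) \<le> max b 0 * norm z" if "z \<in> Z" for z
    using b[OF that] mult_right_mono[of b "max b 0" "norm z"] by simp
  obtain n :: nat where n: "max b 0 * K \<le> n" using real_arch_simple by blast
  have "S n \<subseteq> Z" using Z(1) by blast
  then obtain \<mu>' where "Measure_Space.additive (\<F> n) \<mu>'" "\<And>A. A \<in> \<F> n \<Longrightarrow> norm (\<nu> n A - \<mu>' A) \<le> max b 0 * K"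
    using SVM_transfer_operator[OF Z(2) T(1) b' _ T(2) linear_isometry_inj[OF J] _ \<mu>, of n] unfolding S_def by auto
  then show False using far[of n] n by (meson order_trans)
qed

text \<open>Reduces \<open>SVM_character_greater\<close>, which concerns all cardinals up to
  \<open>\<kappa>\<close>, to \<open>\<kappa>\<close> itself.\<close>

lemma SVM_property_mono:
  fixes \<kappa> \<kappa>' :: "'k rel"
  assumes "SVM_property \<kappa> X" "\<kappa>' \<le>o \<kappa>" shows "SVM_property \<kappa>' X"
proof -
  have "SVM_constants \<kappa> X \<subseteq> SVM_constants \<kappa>' X"
    using ordLess_ordLeq_trans[OF _ assms(2)] unfolding SVM_constants_def by blast
  then show ?thesis using assms(1) unfolding SVM_property_def by blast
qed

text \<open>For \<open>\<kappa>\<close> at most \<open>natLeq\<close>, no space but zero has density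
  character less than \<open>\<kappa>\<close>, so the second part speaks of uncountable
  \<open>\<kappa>\<close>; in the first part this follows from uncountable cofinality.\<close>

theorem theorem5p3:
  fixes \<kappa> :: "'k rel"
  assumes "Card_order \<kappa>"
  shows "(uncountable_cofinality \<kappa> \<and> cardinal_injective \<kappa> TYPE('x::banach) \<longrightarrow>
            SVM_property \<kappa> TYPE('x) \<and> SVM_character_greater TYPE('x) \<kappa>)
       \<and> (\<forall>l\<ge>1. natLeq <o \<kappa> \<and> lambda_injective l \<kappa> TYPE('x) \<longrightarrow>
            SVM_property \<kappa> TYPE('x) \<and> SVM_constant \<kappa> TYPE('x) \<le> 24 * l * Kalton_Roberts_constant)"
proof (rule conjI; intro allI impI; elim conjE)
  assume "uncountable_cofinality \<kappa>" "cardinal_injective \<kappa> TYPE('x)"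
  then have "SVM_property \<kappa> TYPE('x)"
    by (rule cardinal_injective_SVM_property[OF assms _ _ Kalton_Roberts_constants_nonempty])
  then show "SVM_property \<kappa> TYPE('x) \<and> SVM_character_greater TYPE('x) \<kappa>"
    unfolding SVM_character_greater_def using SVM_property_mono[of \<kappa> "TYPE('x)"] by blast
next
  fix l :: real
  assume l: "1 \<le> l" and hyp: "natLeq <o \<kappa>" "lambda_injective l \<kappa> TYPE('x)"
  have C: "l * K \<in> SVM_constants \<kappa> TYPE('x)" if "K \<in> Kalton_Roberts_constants" for K
    using lambda_injective_SVM_constants[OF assms hyp _ that] l by simp
  have ne: "Kalton_Roberts_constants \<noteq> {}" using Kalton_Roberts_constants_nonempty by blast
  have "bdd_below (SVM_constants \<kappa> TYPE('x))"
    by (intro bdd_belowI[of _ 0]) (simp add: SVM_constants_def)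
  \<comment> \<open>Each admissible scalar constant \<open>K\<close> yields \<open>l * K\<close>;
    dividing by \<open>l\<close> allows passing to the infimum over \<open>K\<close> without knowing
    that it is attained.\<close>
  then have "SVM_constant \<kappa> TYPE('x) / l \<le> K" if "K \<in> Kalton_Roberts_constants" for K
    using cInf_lower[OF C[OF that]] l by (simp add: SVM_constant_def divide_le_eq mult.commute)
  then have "SVM_constant \<kappa> TYPE('x) / l \<le> Kalton_Roberts_constant"
    unfolding Kalton_Roberts_constant_def by (intro cInf_greatest ne)
  then have le: "SVM_constant \<kappa> TYPE('x) \<le> l * Kalton_Roberts_constant"
    using l by (simp add: divide_le_eq mult.commute)
  \<comment> \<open>Nonnegativity is what weakens the factor \<open>l\<close> to
    \<open>24 * l\<close>.\<close>
  have "0 \<le> Kalton_Roberts_constant"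
    unfolding Kalton_Roberts_constant_def
    by (intro cInf_greatest ne) (simp add: Kalton_Roberts_constants_def)
  then have "0 \<le> l * Kalton_Roberts_constant" using l by simp
  then have "SVM_constant \<kappa> TYPE('x) \<le> 24 * l * Kalton_Roberts_constant"
    using le unfolding mult.assoc by linarith
  moreover have "SVM_property \<kappa> TYPE('x)"
    unfolding SVM_property_def using C[OF Kalton_Roberts_constants_nonempty] by blast
  ultimately show "SVM_property \<kappa> TYPE('x) \<and> SVM_constant \<kappa> TYPE('x) \<le> 24 * l * Kalton_Roberts_constant"
    by blast
qed

end
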